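(* Let $\Omega=\mathbb{R}\times(-\infty,0)\subset\mathbb{C}$ and $y_0\in(-\infty,0)$. The map achieving $T(iy_0)$ is given by $$u_{y_0}(z)=\begin{cases}\dfrac{2}{z+iy_0}&\text{if }z\in\Omega,\\[2mm]\dfrac{2}{\bar z+iy_0}&\text{if }z\in\mathbb{C}\setminus\Omega.\end{cases}$$ Its energy is given by $T(iy_0)=\frac{4\pi}{y_0^2}$, the corresponding rescaled skyrmion radius is $r_0=y_0^2$ and the limiting energy is $\mathcal{E}_0(\mathrm{id},y_0^2,y_0)=-4\pi y_0^2$.
   Context: Identify $\mathbb{C}$ with $\mathbb{R}^2$. For $y_0<0$, $$T(iy_0)=\inf\left\{\int_{\mathbb{R}^2}|\nabla u|^2dx: u\in H^1_{\mathrm{loc}}(\mathbb{R}^2;\mathbb{C}),\ u(z)=\frac{2}{\bar z+iy_0}\text{ in }\mathbb{C}\setminus\Omega\right\};$$ "the map achieving $T(iy_0)$" is the minimizer of this problem and its energy is $\int_{\mathbb{R}^2}|\nabla u|^2dx=T(iy_0)$. Let $e_3=(0,0,1)$ and $\Phi(x)=\left(-\frac{2x}{1+|x|^2},\frac{1-|x|^2}{1+|x|^2}\right)$ for $x\in\mathbb{R}^2$; for $v\in\mathbb{R}^3$ write $v=(v',v_3)$ with $v'\in\mathbb{R}^2$. For $R_0\in SO(3)$ with $R_0e_3=e_3$, $r_0>0$ and $y_0<0$, $$\mathcal{E}_0(R_0,r_0,y_0)=r_0^2T(iy_0)-2r_0\int_{\mathbb{R}^2}(R_0\Phi)'\cdot\nabla\Phi_3\,dx.$$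 The rescaled skyrmion radius is the minimizer $r_0=\frac{4\pi}{T(iy_0)}$ of $r\mapsto\mathcal{E}_0(\mathrm{id},r,y_0)$ over $r>0$. *)

theory Defs
  imports "HOL-Analysis.Analysis"
begin

text \<open>The plane \<open>\<real>\<^sup>2\<close> is the type \<^typ>\<open>complex\<close>, whose standard basis
  \<^term>\<open>Basis :: complex set\<close> is \<open>{1, \<i>}\<close>.\<close>

definition partial :: "complex \<Rightarrow> (complex \<Rightarrow> real) \<Rightarrow> complex \<Rightarrow> real" where
  "partial b f z = frechet_derivative f (at z) b"

definition gradient :: "(complex \<Rightarrow> real) \<Rightarrow> complex \<Rightarrow> complex" where
  "gradient f z = Complex (partial 1 f z) (partial \<i> f z)"

primrec Ck :: "nat \<Rightarrow> (complex \<Rightarrow> real) \<Rightarrow> bool" where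
  "Ck 0 f \<longleftrightarrow> continuous_on UNIV f"
| "Ck (Suc k) f \<longleftrightarrow> f differentiable_on UNIV \<and> (\<forall>b\<in>Basis. Ck k (partial b f))"

definition test_function :: "(complex \<Rightarrow> real) \<Rightarrow> bool" where
  "test_function \<phi> \<longleftrightarrow> (\<forall>k. Ck k \<phi>) \<and> compact (closure {z. \<phi> z \<noteq> 0})"

definition L2_loc :: "(complex \<Rightarrow> complex) \<Rightarrow> bool" where
  "L2_loc u \<longleftrightarrow> u \<in> borel_measurable lborel \<and>
     (\<forall>K. compact K \<longrightarrow> set_integrable lborel K (\<lambda>z. (norm (u z))\<^sup>2))"

definition is_weak_partial ::
  "complex \<Rightarrow> (complex \<Rightarrow> complex) \<Rightarrow> (complex \<Rightarrow> complex) \<Rightarrow> bool" where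
  "is_weak_partial b u g \<longleftrightarrow> L2_loc g \<and>
     (\<forall>\<phi>. test_function \<phi> \<longrightarrow>
        (LINT z|lborel. partial b \<phi> z *\<^sub>R u z) = - (LINT z|lborel. \<phi> z *\<^sub>R g z))"

definition H1_loc :: "(complex \<Rightarrow> complex) \<Rightarrow> bool" where
  "H1_loc u \<longleftrightarrow> L2_loc u \<and> (\<forall>b\<in>Basis. \<exists>g. is_weak_partial b u g)"

text \<open>Weak derivatives are determined up to null sets, so the energy below does not depend
  on the representative that is chosen here.\<close>

definition weak_partial :: "complex \<Rightarrow> (complex \<Rightarrow> complex) \<Rightarrow> complex \<Rightarrow> complex" where
  "weak_partial b u = (SOME g. is_weak_partial b u g)"

definition dirichlet_energy :: "(complex \<Rightarrow> complex) \<Rightarrow> ennreal" where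
  "dirichlet_energy u =
     (\<integral>\<^sup>+z. ennreal (\<Sum>b\<in>Basis. (norm (weak_partial b u z))\<^sup>2) \<partial>lborel)"

text \<open>Members of \<open>H\<^sup>1\<^sub>l\<^sub>o\<^sub>c\<close> are classes of functions modulo null sets, so the exterior
  condition is imposed almost everywhere.\<close>

definition admissible :: "complex set \<Rightarrow> real \<Rightarrow> (complex \<Rightarrow> complex) \<Rightarrow> bool" where
  "admissible \<Omega> y0 u \<longleftrightarrow> H1_loc u \<and>
     (AE z in lborel. z \<in> - \<Omega> \<longrightarrow> u z = 2 / (cnj z + \<i> * of_real y0))"

text \<open>The real argument \<open>y0\<close> stands for the point \<open>\<i> y0\<close>: \<open>T \<Omega> y0\<close> is \<open>T(\<i> y0)\<close>.\<close>

definition T :: "complex set \<Rightarrow> real \<Rightarrow> ennreal" where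
  "T \<Omega> y0 = (INF u\<in>{u. admissible \<Omega> y0 u}. dirichlet_energy u)"

definition achieves_T :: "complex set \<Rightarrow> real \<Rightarrow> (complex \<Rightarrow> complex) \<Rightarrow> bool" where
  "achieves_T \<Omega> y0 u \<longleftrightarrow> admissible \<Omega> y0 u \<and> dirichlet_energy u = T \<Omega> y0"

definition Phi :: "complex \<Rightarrow> real^3" where
  "Phi x = vector [- (2 * Re x / (1 + (norm x)\<^sup>2)), - (2 * Im x / (1 + (norm x)\<^sup>2)),
                   (1 - (norm x)\<^sup>2) / (1 + (norm x)\<^sup>2)]"

definition horizontal :: "real^3 \<Rightarrow> complex" where
  "horizontal v = Complex (v $ 1) (v $ 2)"

text \<open>Meaningful for \<open>y0 < 0\<close>, \<open>r > 0\<close> and \<open>R \<in> SO(3)\<close> fixing \<open>(0, 0, 1)\<close>.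
  The term \<^term>\<open>enn2real (T \<Omega> y0)\<close> is \<open>0\<close> if \<^term>\<open>T \<Omega> y0 = \<infinity>\<close>.\<close>

definition limiting_energy :: "complex set \<Rightarrow> real^3^3 \<Rightarrow> real \<Rightarrow> real \<Rightarrow> real" where
  "limiting_energy \<Omega> R r y0 = r\<^sup>2 * enn2real (T \<Omega> y0)
     - 2 * r * (LINT x|lborel. horizontal (R *v Phi x) \<bullet> gradient (\<lambda>y. Phi y $ 3) x)"

definition is_rescaled_skyrmion_radius :: "complex set \<Rightarrow> real \<Rightarrow> real \<Rightarrow> bool" where
  "is_rescaled_skyrmion_radius \<Omega> y0 r0 \<longleftrightarrow>
     is_arg_min (\<lambda>r. limiting_energy \<Omega> (mat 1) r y0) (\<lambda>r. 0 < r) r0"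

end

theory Submission
  imports Defs "HOL-Real_Asymp.Real_Asymp"
begin

text \<open>
  Write \<open>a = - y\<^sub>0\<close>, \<open>h(z) = 2 / (z - \<i> a)\<close> and let \<open>w = v - u\<close> be the difference of a competitor and the
  candidate. The competitor equals \<open>u\<close> on the upper half-plane, so minimality and uniqueness both
  follow from \<open>\<integral> \<nabla>u \<cdot> \<nabla>w = 0\<close>. On the lower half-plane \<open>u = h\<close> is holomorphic, so by the Cauchy-Riemann
  equations the gradients of \<open>Re h\<close> and \<open>Im h\<close> are rotated gradients of \<open>Im h\<close> and \<open>- Re h\<close>. Cutting off
  these stream functions, rather than \<open>\<nabla>h\<close> itself, gives compactly supported fields that are exactly
  divergence free, hence orthogonal to \<open>\<nabla>w\<close> for every \<open>w\<close> in \<open>H\<^sup>1\<^sub>l\<^sub>o\<^sub>c\<close> without any control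
  of the growth of \<open>w\<close>; and because \<open>h\<close> decays like \<open>1 / \<bar>z\<bar>\<close> they converge to \<open>\<nabla>h\<close> dominatedly in
  \<open>L\<^sup>2\<close>. The two explicit integrals are computed by Fubini.
\<close>

subsection \<open>Smooth functions on the plane\<close>

text \<open>The candidate is \<open>h\<close> composed with the reflection of the upper half-plane
  onto the lower one. This folding is 1-Lipschitz and keeps the distance to the pole
  \<open>\<i> a\<close> at least \<open>a\<close>, so the candidate is bounded and Lipschitz, and
  its classical derivatives off the real line are its weak derivatives. The obstacle is that a
  competitor is known only through its pairing with test functions: the stream functions must be
  smooth on the whole plane although \<open>h\<close> has a pole. The pole lies in the upper
  half-plane, where \<open>\<nabla>w\<close> vanishes, so there they can be altered at will.
  Orthogonality makes the energy of a competitor of finite energy that of \<open>u\<close> plus that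
  of \<open>w\<close>. Equality leaves \<open>\<nabla>w = 0\<close>, and \<open>w = 0\<close> on the
  upper half-plane then spreads downwards. The constants: \<open>|\<nabla>u|^2 = 8 / d^4\<close>,
  with \<open>d\<close> the distance of the folded point to the pole, integrates to
  \<open>4 pi / a^2\<close>. The integral in the linear term of the limiting energy is
  \<open>4 pi\<close>, and completing the square in \<open>4 pi r^2 / a^2 - 8 pi r\<close> gives the
  radius \<open>a^2\<close> and the value \<open>- 4 pi a^2\<close>.\<close>

lemma partial_has_derivative: "(f has_derivative f') (at z) \<Longrightarrow> partial b f z = f' b"
  unfolding partial_def by (metis frechet_derivative_at)

lemma complex_eq_scaleR_Basis: "h = Re h *\<^sub>R 1 + Im h *\<^sub>R \<i>"
  by (simp add: complex_eq_iff)

lemma has_derivative_partial: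
  assumes "f differentiable (at z)"
  shows "(f has_derivative (\<lambda>h. Re h * partial 1 f z + Im h * partial \<i> f z)) (at z)"
proof -
  from assms obtain f' where f': "(f has_derivative f') (at z)"
    by (auto simp: differentiable_def)
  then interpret bounded_linear f' by (rule has_derivative_bounded_linear)
  have "f' h = Re h * partial 1 f z + Im h * partial \<i> f z" for h
    using add[of "Re h *\<^sub>R 1" "Im h *\<^sub>R \<i>"]
    by (simp add: partial_has_derivative[OF f'] scaleR complex_eq_scaleR_Basis[symmetric])
  then have "f' = (\<lambda>h. Re h * partial 1 f z + Im h * partial \<i> f z)" by blast
  with f' show ?thesis by simp
qed

lemma has_derivative_frechet_partial:
  "f differentiable (at z) \<Longrightarrow> (f has_derivative (\<lambda>b. partial b f z)) (at z)"
  by (simp add: partial_def frechet_derivative_works)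

lemma has_field_derivative_along:
  assumes "f differentiable (at (z + t *\<^sub>R b))"
  shows "((\<lambda>t. f (z + t *\<^sub>R b)) has_real_derivative partial b f (z + t *\<^sub>R b)) (at t)"
proof -
  let ?z = "z + t *\<^sub>R b"
  have "((\<lambda>t. f (z + t *\<^sub>R b)) has_derivative (\<lambda>s. frechet_derivative f (at ?z) (s *\<^sub>R b))) (at t)"
    using assms[unfolded frechet_derivative_works]
    by (rule has_derivative_compose[rotated]) (auto intro!: derivative_eq_intros)
  moreover have "frechet_derivative f (at ?z) (s *\<^sub>R b) = partial b f ?z * s" for s
    using linear_frechet_derivative[OF assms] by (simp add: partial_def linear_cmul mult.commute)
  ultimately show ?thesis by (simp add: has_field_derivative_def)
qed

lemma Ck_SucD:
  assumes "Ck (Suc k) f"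
  shows "f differentiable (at z)" and "b \<in> Basis \<Longrightarrow> Ck k (partial b f)"
  using assms by (auto simp: differentiable_on_def)

lemma Ck_lower: "Ck (Suc k) f \<Longrightarrow> Ck k f"
proof (induction k arbitrary: f)
  case 0
  then show ?case by (simp add: differentiable_imp_continuous_on)
next
  case (Suc k)
  from Suc.prems have "f differentiable_on UNIV" "\<forall>b\<in>Basis. Ck (Suc k) (partial b f)"
    unfolding Ck.simps(2)[of "Suc k"] by auto
  with Suc.IH show ?case by simp
qed

lemma Ck_const: "Ck k (\<lambda>_. c)"
proof (induction k arbitrary: c)
  case (Suc k)
  have "partial b (\<lambda>_. c) = (\<lambda>_. 0)" for b
    by (rule ext, rule partial_has_derivative) (rule has_derivative_const)
  with Suc show ?case by simp
qed simp

lemma Ck_bounded_linear: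
  assumes "bounded_linear f"
  shows "Ck k f"
proof (cases k)
  case (Suc k)
  have "partial b f = (\<lambda>_. f b)" for b
    by (rule ext, rule partial_has_derivative) (rule bounded_linear_imp_has_derivative[OF assms])
  with Suc show ?thesis
    by (simp add: Ck_const bounded_linear_imp_differentiable_on[OF assms])
qed (simp add: bounded_linear.continuous_on[OF assms continuous_on_id])

lemma Ck_add: "Ck k f \<Longrightarrow> Ck k g \<Longrightarrow> Ck k (\<lambda>z. f z + g z)"
proof (induction k arbitrary: f g)
  case (Suc k)
  note d = Ck_SucD(1)[OF Suc.prems(1)] Ck_SucD(1)[OF Suc.prems(2)]
  have "partial b (\<lambda>z. f z + g z) = (\<lambda>z. partial b f z + partial b g z)" for b
    by (rule ext, rule partial_has_derivative)
      (intro has_derivative_add has_derivative_frechet_partial d)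
  with Suc show ?case by (auto simp: differentiable_on_add)
qed (auto intro: continuous_intros)

lemma partial_mult:
  assumes "f differentiable (at z)" "g differentiable (at z)"
  shows "partial b (\<lambda>z. f z * g z) z = f z * partial b g z + partial b f z * g z"
  using partial_has_derivative[OF has_derivative_mult[OF
      has_derivative_frechet_partial[OF assms(1)] has_derivative_frechet_partial[OF assms(2)]]]
  by simp

lemma Ck_mult: "Ck k f \<Longrightarrow> Ck k g \<Longrightarrow> Ck k (\<lambda>z. f z * g z)"
proof (induction k arbitrary: f g)
  case (Suc k)
  note d = Ck_SucD(1)[OF Suc.prems(1)] Ck_SucD(1)[OF Suc.prems(2)]
  have "partial b (\<lambda>z. f z * g z) = (\<lambda>z. f z * partial b g z + partial b f z * g z)" for b
    using partial_mult[OF d] by blast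
  with Suc Suc.prems[THEN Ck_lower] show ?case
    by (auto intro!: Ck_add Suc.IH differentiable_on_mult)
qed (auto intro: continuous_intros)

lemma Ck_diff: "Ck k f \<Longrightarrow> Ck k g \<Longrightarrow> Ck k (\<lambda>z. f z - g z)"
  using Ck_add[of k f "\<lambda>z. (- 1) * g z"] Ck_mult[OF Ck_const[of k "- 1"], of g] by simp

text \<open>The derivative of \<open>1 / f\<close> is a product of \<open>partial b f\<close> and
  two factors \<open>1 / f\<close>, which are needed only to the order already reached; so the
  induction runs with \<open>f\<close> fixed.\<close>

lemma Ck_inverse:
  assumes "Ck k f" "\<And>z. f z \<noteq> 0"
  shows "Ck k (\<lambda>z. inverse (f z))"
  using assms(1)
proof (induction k)
  case (Suc k)
  note d = Ck_SucD(1)[OF Suc.prems]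
  have p: "partial b (\<lambda>z. inverse (f z)) = (\<lambda>z. (- 1) * ((inverse (f z) * partial b f z) * inverse (f z)))" for b
    by (rule ext, rule partial_has_derivative[THEN trans])
      (rule Deriv.has_derivative_inverse[OF assms(2) has_derivative_frechet_partial[OF d]], simp)
  have "(\<lambda>z. inverse (f z)) differentiable (at z)" for z
    using Deriv.has_derivative_inverse[OF assms(2) has_derivative_frechet_partial[OF d]]
    by (auto simp: differentiable_def)
  with Suc.IH[OF Ck_lower[OF Suc.prems]] Ck_SucD(2)[OF Suc.prems] show ?case
    unfolding Ck.simps p
    by (intro conjI ballI Ck_mult Ck_const) (auto simp: differentiable_on_def)
qed (auto intro!: continuous_intros simp: assms(2))

section \<open>Functions that are flat at the origin\<close>

text \<open>The polynomial factor makes this class of functions closed under differentiation.\<close>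

definition flat_exp :: "real poly \<Rightarrow> real \<Rightarrow> real" where
  "flat_exp p t = (if 0 < t then poly p (1 / t) * exp (- (1 / t)) else 0)"

lemma poly_mult_exp_minus_tendsto: "((\<lambda>s. poly p s * exp (- s)) \<longlongrightarrow> (0::real)) at_top"
proof -
  have "((\<lambda>s. \<Sum>i\<le>degree p. coeff p i * (s ^ i / exp s)) \<longlongrightarrow> (\<Sum>i\<le>degree p. coeff p i * 0)) at_top"
    by (intro tendsto_intros tendsto_power_div_exp_0)
  then show ?thesis
    by (simp add: poly_altdef sum_distrib_right exp_minus field_simps sum_divide_distrib)
qed

lemma flat_exp_tendsto_0: "(flat_exp p \<longlongrightarrow> 0) (at 0)"
proof (rule filterlim_split_at)
  have "eventually (\<lambda>t. 0 = flat_exp p t) (at_left 0)"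
    by (rule eventually_at_leftI[of "-1"]) (auto simp: flat_exp_def)
  then show "(flat_exp p \<longlongrightarrow> 0) (at_left 0)"
    by (rule Lim_transform_eventually[OF tendsto_const])
  have "((\<lambda>t. poly p (inverse t) * exp (- inverse t)) \<longlongrightarrow> 0) (at_right 0)"
    by (rule filterlim_compose[OF poly_mult_exp_minus_tendsto filterlim_inverse_at_top_right])
  moreover have "eventually (\<lambda>t. poly p (inverse t) * exp (- inverse t) = flat_exp p t) (at_right 0)"
    by (rule eventually_at_rightI[of _ 1]) (auto simp: flat_exp_def divide_inverse)
  ultimately show "(flat_exp p \<longlongrightarrow> 0) (at_right 0)"
    by (rule Lim_transform_eventually)
qed

text \<open>In the variable \<open>s = 1 / t\<close> one has \<open>d/dt = - s^2 d/ds\<close>, so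
  \<open>p(s) exp(-s)\<close> has the derivative \<open>s^2 (p - p')(s) exp(-s)\<close>; the
  polynomial \<open>[:0, 0, 1:]\<close> is \<open>s^2\<close>.\<close>

lemma flat_exp_DERIV:
  "(flat_exp p has_real_derivative flat_exp ([:0, 0, 1:] * (p - pderiv p)) t) (at t)"
proof -
  let ?q = "[:0, 0, 1:] * (p - pderiv p)"
  consider "t < 0" | "t = 0" | "0 < t" by linarith
  then show ?thesis
  proof cases
    case 1
    have "((\<lambda>_. 0::real) has_real_derivative flat_exp ?q t) (at t)"
      using 1 by (simp add: flat_exp_def)
    then show ?thesis
      by (rule DERIV_cong_ev[THEN iffD1, rotated 3])
        (use 1 in \<open>auto simp: flat_exp_def intro!: eventually_nhds_in_open[of "{..<0}", THEN eventually_mono]\<close>)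
  next
    case 2
    \<comment> \<open>Dividing by \<open>h\<close> multiplies the polynomial by
      \<open>s = 1 / h\<close>: the difference quotient at the origin is again a flat function and
      tends to 0.\<close>
    have "(flat_exp p h - flat_exp p 0) / h = flat_exp ([:0, 1:] * p) h" for h
      by (simp add: flat_exp_def)
    moreover have "flat_exp ?q 0 = 0" by (simp add: flat_exp_def)
    ultimately show ?thesis
      using flat_exp_tendsto_0[of "[:0, 1:] * p"] by (simp only: DERIV_def 2 add_0)
  next
    case 3
    have "((\<lambda>t. poly p (1 / t) * exp (- (1 / t))) has_real_derivative flat_exp ?q t) (at t)"
      using 3 by (auto intro!: derivative_eq_intros simp: flat_exp_def field_simps power2_eq_square)
    then show ?thesis
      by (rule DERIV_cong_ev[THEN iffD1, rotated 3])
        (use 3 in \<open>auto simp: flat_exp_def intro!: eventually_nhds_in_open[of "{0<..}", THEN eventually_mono]\<close>)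
  qed
qed

lemma Ck_flat_exp: "Ck k f \<Longrightarrow> Ck k (\<lambda>z. flat_exp p (f z))"
proof (induction k arbitrary: p)
  case 0
  have "isCont (flat_exp p) t" for t
    using DERIV_isCont[OF flat_exp_DERIV] .
  then have "continuous_on UNIV (flat_exp p)" by (simp add: continuous_at_imp_continuous_on)
  then have "continuous_on UNIV (\<lambda>z. flat_exp p (f z))"
    by (rule continuous_on_compose2) (use 0 in auto)
  then show ?case by simp
next
  case (Suc k)
  note d = Ck_SucD(1)[OF Suc.prems]
  let ?q = "[:0, 0, 1:] * (p - pderiv p)"
  have h: "((\<lambda>z. flat_exp p (f z)) has_derivative (\<lambda>b. flat_exp ?q (f z) * partial b f z)) (at z)" for z
    using has_derivative_compose[OF has_derivative_frechet_partial[OF d[of z]]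
        flat_exp_DERIV[of p, unfolded has_field_derivative_def]] .
  have "partial b (\<lambda>z. flat_exp p (f z)) = (\<lambda>z. flat_exp ?q (f z) * partial b f z)" for b
    using partial_has_derivative[OF h] by blast
  moreover have "(\<lambda>z. flat_exp p (f z)) differentiable_on UNIV"
    using h by (auto simp: differentiable_on_def differentiable_def)
  ultimately show ?case
    using Suc.IH[OF Ck_lower[OF Suc.prems]] Ck_SucD(2)[OF Suc.prems] by (auto intro!: Ck_mult)
qed

subsection \<open>Symmetry of second derivatives\<close>

text \<open>The mean value theorem is applied along \<open>b\<close> to a difference in direction
  \<open>c\<close>, and once more along \<open>c\<close>. The left-hand side is symmetric in
  \<open>b\<close> and \<open>c\<close>, the right-hand side is not.\<close>

lemma second_difference:
  assumes f: "Ck 2 f" and b: "b \<in> Basis" "c \<in> Basis" and h: "0 < h"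
  shows "\<exists>s t. 0 < s \<and> s < h \<and> 0 < t \<and> t < h \<and>
    f (z + h *\<^sub>R b + h *\<^sub>R c) - f (z + h *\<^sub>R b) - f (z + h *\<^sub>R c) + f z
      = h * h * partial c (partial b f) (z + s *\<^sub>R b + t *\<^sub>R c)"
proof -
  from f have f2: "Ck (Suc (Suc 0)) f" by (simp only: numeral_2_eq_2)
  note df = Ck_SucD(1)[OF f2] and dpf = Ck_SucD(1)[OF Ck_SucD(2)[OF f2 b(1)]]
  define g where "g s = f (z + h *\<^sub>R c + s *\<^sub>R b) - f (z + s *\<^sub>R b)" for s
  have "(g has_real_derivative partial b f (z + h *\<^sub>R c + s *\<^sub>R b) - partial b f (z + s *\<^sub>R b)) (at s)" for s
    unfolding g_def by (intro DERIV_diff has_field_derivative_along df)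
  from MVT2[OF h, of g "\<lambda>s. partial b f (z + h *\<^sub>R c + s *\<^sub>R b) - partial b f (z + s *\<^sub>R b)", OF this]
  obtain s where s: "0 < s" "s < h"
    "g h - g 0 = (h - 0) * (partial b f (z + h *\<^sub>R c + s *\<^sub>R b) - partial b f (z + s *\<^sub>R b))"
    by blast
  have "((\<lambda>t. partial b f (z + s *\<^sub>R b + t *\<^sub>R c)) has_real_derivative
      partial c (partial b f) (z + s *\<^sub>R b + t *\<^sub>R c)) (at t)" for t
    by (intro has_field_derivative_along dpf)
  from MVT2[OF h, of "\<lambda>t. partial b f (z + s *\<^sub>R b + t *\<^sub>R c)"
      "\<lambda>t. partial c (partial b f) (z + s *\<^sub>R b + t *\<^sub>R c)", OF this]
  obtain t where t: "0 < t" "t < h"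
    "partial b f (z + s *\<^sub>R b + h *\<^sub>R c) - partial b f (z + s *\<^sub>R b + 0 *\<^sub>R c)
      = (h - 0) * partial c (partial b f) (z + s *\<^sub>R b + t *\<^sub>R c)"
    by blast
  have "g h - g 0 = h * h * partial c (partial b f) (z + s *\<^sub>R b + t *\<^sub>R c)"
    using s(3) t(3) by (simp add: algebra_simps)
  with s t show ?thesis
    by (intro exI[of _ s] exI[of _ t] conjI) (simp_all add: g_def algebra_simps)
qed

text \<open>Evaluating the same second difference in both orders gives equal values of the two mixed
  derivatives at two points of a square of side \<open>h\<close> at \<open>z\<close>; both points
  tend to \<open>z\<close>, and the mixed derivatives are continuous.\<close>

lemma partial_commute:
  assumes f: "Ck 2 f" and b: "b \<in> Basis" "c \<in> Basis"
  shows "partial c (partial b f) z = partial b (partial c f) z"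
proof -
  have cont: "isCont (partial c (partial b f)) w" if "b \<in> Basis" "c \<in> Basis" for b c w
    using f that by (auto simp: numeral_2_eq_2 continuous_on_eq_continuous_at)
  define h where "h n = inverse (real (Suc n))" for n
  have h0: "h \<longlonglongrightarrow> 0" unfolding h_def by (rule LIMSEQ_inverse_real_of_nat)
  have hp: "0 < h n" for n by (simp add: h_def)
  have lim: "\<exists>x. x \<longlonglongrightarrow> z \<and> (\<forall>n. f (z + h n *\<^sub>R b + h n *\<^sub>R c) - f (z + h n *\<^sub>R b) - f (z + h n *\<^sub>R c) + f z
      = h n * h n * partial c (partial b f) (x n))" if "b \<in> Basis" "c \<in> Basis" for b c
  proof -
    have "\<forall>n. \<exists>s t. 0 < s \<and> s < h n \<and> 0 < t \<and> t < h n \<and>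
      f (z + h n *\<^sub>R b + h n *\<^sub>R c) - f (z + h n *\<^sub>R b) - f (z + h n *\<^sub>R c) + f z
        = h n * h n * partial c (partial b f) (z + s *\<^sub>R b + t *\<^sub>R c)"
      using second_difference[OF f that hp] by blast
    then obtain s t where st:
      "\<And>n. 0 < s n" "\<And>n. s n < h n" "\<And>n. 0 < t n" "\<And>n. t n < h n"
      "\<And>n. f (z + h n *\<^sub>R b + h n *\<^sub>R c) - f (z + h n *\<^sub>R b) - f (z + h n *\<^sub>R c) + f z
        = h n * h n * partial c (partial b f) (z + s n *\<^sub>R b + t n *\<^sub>R c)"
      unfolding choice_iff by blast
    have "s \<longlonglongrightarrow> 0"
      by (rule tendsto_sandwich[OF _ _ tendsto_const h0]) (use st in \<open>auto intro!: always_eventually less_imp_le\<close>)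
    moreover have "t \<longlonglongrightarrow> 0"
      by (rule tendsto_sandwich[OF _ _ tendsto_const h0]) (use st in \<open>auto intro!: always_eventually less_imp_le\<close>)
    ultimately have "(\<lambda>n. z + s n *\<^sub>R b + t n *\<^sub>R c) \<longlonglongrightarrow> z + 0 *\<^sub>R b + 0 *\<^sub>R c"
      by (intro tendsto_intros)
    with st(5) show ?thesis by (intro exI[of _ "\<lambda>n. z + s n *\<^sub>R b + t n *\<^sub>R c"]) auto
  qed
  from lim[OF b] obtain x where x: "x \<longlonglongrightarrow> z"
    "\<And>n. f (z + h n *\<^sub>R b + h n *\<^sub>R c) - f (z + h n *\<^sub>R b) - f (z + h n *\<^sub>R c) + f z
      = h n * h n * partial c (partial b f) (x n)" by blast
  from lim[OF b(2,1)] obtain y where y: "y \<longlonglongrightarrow> z"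
    "\<And>n. f (z + h n *\<^sub>R c + h n *\<^sub>R b) - f (z + h n *\<^sub>R c) - f (z + h n *\<^sub>R b) + f z
      = h n * h n * partial b (partial c f) (y n)" by blast
  have "partial c (partial b f) (x n) = partial b (partial c f) (y n)" for n
  proof -
    have "h n * h n * partial c (partial b f) (x n) = h n * h n * partial b (partial c f) (y n)"
      unfolding x(2)[symmetric] y(2)[symmetric] by (simp add: algebra_simps)
    with hp[of n] show ?thesis by simp
  qed
  moreover have "(\<lambda>n. partial c (partial b f) (x n)) \<longlonglongrightarrow> partial c (partial b f) z"
    using isCont_tendsto_compose[OF cont[OF b] x(1)] .
  moreover have "(\<lambda>n. partial b (partial c f) (y n)) \<longlonglongrightarrow> partial b (partial c f) z"
    using isCont_tendsto_compose[OF cont[OF b(2,1)] y(1)] .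
  ultimately show ?thesis using LIMSEQ_unique by auto
qed

subsection \<open>Test functions\<close>

lemma test_functionI:
  assumes "\<And>k. Ck k \<phi>" "\<And>z. r < norm z \<Longrightarrow> \<phi> z = 0"
  shows "test_function \<phi>"
proof -
  have "{z. \<phi> z \<noteq> 0} \<subseteq> cball 0 r"
    using assms(2) by (auto simp: not_less[symmetric])
  then have "bounded {z. \<phi> z \<noteq> 0}" by (rule bounded_subset[OF bounded_cball])
  with assms(1) show ?thesis by (simp add: test_function_def compact_closure)
qed

lemma test_function_Ck: "test_function \<phi> \<Longrightarrow> Ck k \<phi>"
  by (simp add: test_function_def)

lemma test_function_differentiable: "test_function \<phi> \<Longrightarrow> \<phi> differentiable (at z)"
  by (rule Ck_SucD(1)[OF test_function_Ck])

lemma test_function_support: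
  assumes "test_function \<phi>"
  obtains r where "0 < r" "\<And>z. r < norm z \<Longrightarrow> \<phi> z = 0"
proof -
  have "bounded (closure {z. \<phi> z \<noteq> 0})"
    using assms by (simp add: test_function_def compact_imp_bounded)
  then have "bounded {z. \<phi> z \<noteq> 0}" by (rule bounded_subset[OF _ closure_subset])
  then obtain r where "0 < r" "\<forall>z\<in>{z. \<phi> z \<noteq> 0}. norm z \<le> r" by (auto simp: bounded_pos)
  then show thesis by (intro that[of r]) (auto simp: not_le[symmetric])
qed

lemma partial_eq_0_open:
  assumes "open S" "z \<in> S" "\<And>w. w \<in> S \<Longrightarrow> f w = 0"
  shows "partial b f z = 0"
proof -
  have "((\<lambda>_. 0) has_derivative (\<lambda>_. 0)) (at z)" by (rule has_derivative_const)
  then have "(f has_derivative (\<lambda>_. 0)) (at z)"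
    by (rule has_derivative_transform_within_open[OF _ assms(1,2)]) (simp add: assms(3))
  then show ?thesis by (rule partial_has_derivative)
qed

lemma test_function_partial:
  assumes "test_function \<phi>" "b \<in> Basis"
  shows "test_function (partial b \<phi>)"
proof -
  obtain r where r: "\<And>z. r < norm z \<Longrightarrow> \<phi> z = 0"
    using test_function_support[OF assms(1)] by blast
  have "open {z::complex. r < norm z}" by (intro open_Collect_less continuous_intros)
  then have "partial b \<phi> z = 0" if "r < norm z" for z
    by (rule partial_eq_0_open) (use r that in auto)
  then show ?thesis
    using test_functionI Ck_SucD(2)[OF test_function_Ck[OF assms(1)] assms(2)] by blast
qed

lemma test_function_continuous: "test_function \<phi> \<Longrightarrow> continuous_on UNIV \<phi>"
  using test_function_Ck[of \<phi> 0] by simp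

lemma test_function_measurable [measurable]: "test_function \<phi> \<Longrightarrow> \<phi> \<in> borel_measurable borel"
  by (intro borel_measurable_continuous_onI test_function_continuous)

lemma test_function_bounded:
  assumes "test_function \<phi>"
  obtains C where "0 < C" "\<And>z. \<bar>\<phi> z\<bar> \<le> C"
proof -
  obtain r where r: "\<And>z. r < norm z \<Longrightarrow> \<phi> z = 0"
    using test_function_support[OF assms] by blast
  have "bounded (\<phi> ` cball 0 r)"
    using test_function_continuous[OF assms]
    by (intro compact_imp_bounded compact_continuous_image) (auto intro: continuous_on_subset)
  then obtain C where C: "0 < C" "\<forall>x\<in>\<phi> ` cball 0 r. norm x \<le> C" by (auto simp: bounded_pos)
  have "\<bar>\<phi> z\<bar> \<le> C" for z
    using C r[of z] by (cases "norm z \<le> r") auto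
  with C show thesis by (intro that)
qed

lemma test_function_mult:
  assumes "test_function \<phi>" "\<And>k. Ck k \<psi>"
  shows "test_function (\<lambda>z. \<phi> z * \<psi> z)"
proof -
  obtain r where r: "\<And>z. r < norm z \<Longrightarrow> \<phi> z = 0"
    using test_function_support[OF assms(1)] by blast
  show ?thesis
    by (rule test_functionI[of _ r]) (use r in \<open>simp_all add: Ck_mult test_function_Ck assms\<close>)
qed

lemma test_function_lipschitz:
  assumes "test_function \<phi>"
  obtains L where "0 < L" "\<And>z w. \<bar>\<phi> z - \<phi> w\<bar> \<le> L * norm (z - w)"
proof -
  obtain C where C: "0 < C" "\<And>z. \<bar>partial 1 \<phi> z\<bar> \<le> C"
    using test_function_bounded[OF test_function_partial[OF assms, of 1]] by (auto simp: Basis_complex_def)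
  obtain D where D: "0 < D" "\<And>z. \<bar>partial \<i> \<phi> z\<bar> \<le> D"
    using test_function_bounded[OF test_function_partial[OF assms, of \<i>]] by (auto simp: Basis_complex_def)
  have "norm (\<phi> z - \<phi> w) \<le> (C + D) * norm (z - w)" for z w
  proof (rule differentiable_bound[of UNIV])
    show "(\<phi> has_derivative (\<lambda>h. Re h * partial 1 \<phi> x + Im h * partial \<i> \<phi> x)) (at x within UNIV)" for x
      by (simp add: has_derivative_partial test_function_differentiable[OF assms])
    show "onorm (\<lambda>h. Re h * partial 1 \<phi> x + Im h * partial \<i> \<phi> x) \<le> C + D" for x
    proof (rule onorm_le)
      fix h
      have "\<bar>Re h * partial 1 \<phi> x + Im h * partial \<i> \<phi> x\<bar> \<le> \<bar>Re h\<bar> * \<bar>partial 1 \<phi> x\<bar> + \<bar>Im h\<bar> * \<bar>partial \<i> \<phi> x\<bar>"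
        by (metis abs_triangle_ineq abs_mult)
      also have "\<dots> \<le> norm h * C + norm h * D"
        by (intro add_mono mult_mono) (auto intro: abs_Re_le_cmod abs_Im_le_cmod C D)
      finally show "norm (Re h * partial 1 \<phi> x + Im h * partial \<i> \<phi> x) \<le> (C + D) * norm h"
        by (simp add: algebra_simps)
    qed
  qed auto
  with C D show thesis by (intro that[of "C + D"]) auto
qed

lemma partial_translate:
  assumes "\<phi> differentiable (at (z + c))"
  shows "partial b (\<lambda>z. \<phi> (z + c)) z = partial b \<phi> (z + c)"
proof -
  have "((\<lambda>z. z + c) has_derivative (\<lambda>h. h)) (at z)"
    by (auto intro!: derivative_eq_intros)
  from has_derivative_compose[OF this, of \<phi>, OF has_derivative_frechet_partial[OF assms]]
  show ?thesis by (rule partial_has_derivative)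
qed

lemma Ck_translate: "Ck k \<phi> \<Longrightarrow> Ck k (\<lambda>z. \<phi> (z + c))"
proof (induction k arbitrary: \<phi>)
  case 0
  have "continuous_on UNIV (\<lambda>z. \<phi> (z + c))"
    by (rule continuous_on_compose2[of UNIV \<phi>]) (use 0 in \<open>auto intro!: continuous_intros\<close>)
  then show ?case by simp
next
  case (Suc k)
  note d = Ck_SucD(1)[OF Suc.prems]
  have "partial b (\<lambda>z. \<phi> (z + c)) = (\<lambda>z. partial b \<phi> (z + c))" for b
    using partial_translate[OF d] by blast
  moreover have "(\<lambda>z. \<phi> (z + c)) differentiable (at z)" for z
    using differentiable_chain_at[of "\<lambda>z. z + c" z \<phi>] d by (simp add: o_def)
  ultimately show ?case
    using Suc by (auto simp: differentiable_on_def)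
qed

lemma test_function_translate:
  assumes "test_function \<phi>"
  shows "test_function (\<lambda>z. \<phi> (z + c))"
proof -
  obtain r where r: "\<And>z. r < norm z \<Longrightarrow> \<phi> z = 0"
    using test_function_support[OF assms] by blast
  show ?thesis
  proof (rule test_functionI[of _ "r + norm c"])
    show "\<phi> (z + c) = 0" if "r + norm c < norm z" for z
      using that norm_triangle_ineq4[of "z + c" c] by (intro r) simp
  qed (simp add: Ck_translate test_function_Ck assms)
qed

section \<open>A smooth transition from 0 to 1\<close>

definition smooth_step :: "real \<Rightarrow> real" where
  "smooth_step t = flat_exp 1 t * inverse (flat_exp 1 t + flat_exp 1 (1 - t))"

lemma flat_exp_1_pos: "0 < t \<Longrightarrow> 0 < flat_exp 1 t"
  and flat_exp_1_nonneg: "0 \<le> flat_exp 1 t"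
  and flat_exp_nonpos: "t \<le> 0 \<Longrightarrow> flat_exp p t = 0"
  by (auto simp: flat_exp_def)

text \<open>At least one of \<open>t\<close> and \<open>1 - t\<close> is positive, and
  \<open>flat_exp 1\<close> is positive there.\<close>

lemma smooth_step_denom_pos: "0 < flat_exp 1 t + flat_exp 1 (1 - t)"
  using flat_exp_1_pos[of t] flat_exp_1_pos[of "1 - t"] flat_exp_1_nonneg[of t] flat_exp_1_nonneg[of "1 - t"]
  by (cases "0 < t") auto

lemma smooth_step_eq_0: "t \<le> 0 \<Longrightarrow> smooth_step t = 0"
  by (simp add: smooth_step_def flat_exp_nonpos)

lemma smooth_step_eq_1: "1 \<le> t \<Longrightarrow> smooth_step t = 1"
  using smooth_step_denom_pos[of t] by (simp add: smooth_step_def flat_exp_nonpos)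

lemma smooth_step_pos: "0 < t \<Longrightarrow> 0 < smooth_step t"
  using smooth_step_denom_pos[of t] flat_exp_1_pos[of t] by (simp add: smooth_step_def)

lemma smooth_step_nonneg: "0 \<le> smooth_step t"
  using smooth_step_denom_pos[of t] flat_exp_1_nonneg[of t] by (simp add: smooth_step_def)

lemma smooth_step_le_1: "smooth_step t \<le> 1"
  using smooth_step_denom_pos[of t] flat_exp_1_nonneg[of "1 - t"]
  by (simp add: smooth_step_def divide_inverse[symmetric])

lemma Ck_smooth_step:
  assumes "Ck k f"
  shows "Ck k (\<lambda>z. smooth_step (f z))"
proof -
  have "flat_exp 1 t + flat_exp 1 (1 - t) \<noteq> 0" for t
    using smooth_step_denom_pos[of t] by simp
  then show ?thesis
    unfolding smooth_step_def
    by (intro Ck_mult Ck_inverse Ck_add Ck_flat_exp Ck_diff Ck_const assms)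
qed

lemma Ck_Re: "Ck k Re" and Ck_Im: "Ck k Im"
  by (rule Ck_bounded_linear, rule bounded_linear_Re, rule Ck_bounded_linear, rule bounded_linear_Im)

subsection \<open>The fundamental lemma of the calculus of variations\<close>

text \<open>Each factor switches on at one side of the box, over a width \<open>1 / n\<close>. The
  support stays in the box for every \<open>n\<close>, so the bumps approach the indicator from
  inside, without any convolution.\<close>

definition box_bump :: "complex \<Rightarrow> complex \<Rightarrow> nat \<Rightarrow> complex \<Rightarrow> real" where
  "box_bump l u n z = smooth_step (real n * (Re z - Re l)) * smooth_step (real n * (Re u - Re z))
     * (smooth_step (real n * (Im z - Im l)) * smooth_step (real n * (Im u - Im z)))"

lemma in_box_complex: "z \<in> box l u \<longleftrightarrow> Re l < Re z \<and> Re z < Re u \<and> Im l < Im z \<and> Im z < Im u"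
  by (auto simp: box_def Basis_complex_def)

lemma smooth_step_scaled_nonpos: "t \<le> 0 \<Longrightarrow> smooth_step (real n * t) = 0"
  by (rule smooth_step_eq_0) (simp add: mult_nonneg_nonpos)

lemma box_bump_outside: "z \<notin> box l u \<Longrightarrow> box_bump l u n z = 0"
  unfolding in_box_complex box_bump_def
  using smooth_step_scaled_nonpos[of "Re z - Re l" n] smooth_step_scaled_nonpos[of "Re u - Re z" n]
    smooth_step_scaled_nonpos[of "Im z - Im l" n] smooth_step_scaled_nonpos[of "Im u - Im z" n]
  by (auto simp: not_less)

lemma test_function_box_bump: "test_function (box_bump l u n)"
proof -
  have "bounded (box l u)" by simp
  then obtain r where r: "\<And>z. z \<in> box l u \<Longrightarrow> norm z \<le> r" by (auto simp: bounded_iff)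
  have "Ck k (box_bump l u n)" for k
    unfolding box_bump_def
    by (intro Ck_mult Ck_smooth_step Ck_diff Ck_const Ck_Re Ck_Im)
  then show ?thesis
    by (rule test_functionI[of _ r]) (use r box_bump_outside in \<open>force simp: not_le[symmetric]\<close>)
qed

lemma box_bump_range: "\<bar>box_bump l u n z\<bar> \<le> 1"
  unfolding box_bump_def abs_mult
  by (intro mult_le_one abs_ge_zero mult_nonneg_nonneg) (auto simp: smooth_step_nonneg smooth_step_le_1)

lemma smooth_step_scaled_tendsto: "0 < t \<Longrightarrow> (\<lambda>n. smooth_step (real n * t)) \<longlonglongrightarrow> 1"
proof -
  assume t: "0 < t"
  obtain N where "1 / t < real N" using reals_Archimedean2 by blast
  then have "eventually (\<lambda>n. 1 \<le> real n * t) sequentially"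
  proof (intro eventually_sequentiallyI[of N])
    fix n assume "1 / t < real N" "N \<le> n"
    then have "1 / t \<le> real n" by (smt (verit) of_nat_le_iff)
    with t show "1 \<le> real n * t" by (simp add: field_simps)
  qed
  then show ?thesis
    by (intro tendsto_eventually) (auto elim!: eventually_mono simp: smooth_step_eq_1)
qed

lemma box_bump_tendsto: "(\<lambda>n. box_bump l u n z) \<longlonglongrightarrow> indicator (box l u) z"
proof (cases "z \<in> box l u")
  case True
  then have "(\<lambda>n. box_bump l u n z) \<longlonglongrightarrow> 1 * 1 * (1 * 1)"
    unfolding box_bump_def in_box_complex
    by (intro tendsto_mult smooth_step_scaled_tendsto) auto
  with True show ?thesis by simp
qed (simp add: box_bump_outside)

text \<open>Boxes generate the Borel sets and are stable under intersection, so by Dynkin's argument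
  the integral vanishes over every Borel set; an integrable density with this property is zero
  almost everywhere.\<close>

lemma AE_eq_0_if_integral_box_eq_0:
  fixes f :: "complex \<Rightarrow> complex"
  assumes f: "integrable lborel f"
    and box: "\<And>l u. (LINT z:box l u|lborel. f z) = 0"
  shows "AE z in lborel. f z = 0"
proof (rule sigma_finite_measure.density_unique_banach[OF sigma_finite_lborel f integrable_zero])
  let ?E = "range (\<lambda>(a, b). box a b :: complex set)"
  fix A :: "complex set" assume "A \<in> sets lborel"
  then have A: "A \<in> sigma_sets UNIV ?E" by (simp add: borel_eq_box)
  have S: "set_integrable lborel A f" if "A \<in> sigma_sets UNIV ?E" for A
    using f that by (intro integrable_mult_indicator[of _ lborel f, folded set_integrable_def])
      (simp_all add: borel_eq_box)
  \<comment> \<open>Passing to complements needs the integral over the whole plane, which is not a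
    box but an increasing union of boxes.\<close>
  have tot: "(LINT z|lborel. f z) = 0"
  proof -
    let ?b = "\<lambda>n. box (- (real n *\<^sub>R One)) (real n *\<^sub>R One) :: complex set"
    have "(\<lambda>n. LINT z:?b n|lborel. f z) \<longlonglongrightarrow> (LINT z:(\<Union>n. ?b n)|lborel. f z)"
    proof (rule set_integral_cont_up)
      show "incseq ?b"
        by (rule monoI) (auto simp: in_box_complex Basis_complex_def)
      show "set_integrable lborel (\<Union>n. ?b n) f"
        using f unfolding UN_box_eq_UNIV by (simp add: set_integrable_def)
    qed auto
    then show ?thesis
      unfolding UN_box_eq_UNIV box by (simp add: LIMSEQ_const_iff set_lebesgue_integral_def)
  qed
  have "Int_stable ?E" by (auto simp: Int_stable_def box_Int_box)
  moreover have "?E \<subseteq> Pow UNIV" by simp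
  ultimately have "(LINT z:A|lborel. f z) = 0"
    using A
  proof (induction rule: sigma_sets_induct_disjoint)
    case (basic A)
    then show ?case using box by auto
  next
    case (compl A)
    have "(LINT z:UNIV|lborel. f z) = (LINT z:A|lborel. f z) + (LINT z:UNIV - A|lborel. f z)"
      using compl S[OF compl(1)] S[OF sigma_sets.Compl[OF compl(1)]]
        set_integral_Un[of A "UNIV - A" lborel f] by simp
    with compl tot show ?case by (simp add: set_lebesgue_integral_def)
  next
    case (union A)
    have "(LINT z:(\<Union>i. A i)|lborel. f z) = (\<Sum>i. LINT z:A i|lborel. f z)"
      using union f
      by (intro lebesgue_integral_countable_add S sigma_sets.Union)
        (auto simp: disjoint_family_on_def borel_eq_box)
    with union show ?case by simp
  qed (simp add: set_lebesgue_integral_def)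
  then show "(LINT z:A|lborel. f z) = (LINT z:A|lborel. 0)" by simp
qed

lemma L2_locD: "L2_loc g \<Longrightarrow> g \<in> borel_measurable borel"
  "L2_loc g \<Longrightarrow> compact K \<Longrightarrow> set_integrable lborel K (\<lambda>z. (norm (g z))\<^sup>2)"
  by (simp_all add: L2_loc_def)

text \<open>On a set of finite measure the bound \<open>norm (g z) \<le> 1 + (norm (g z))^2\<close>
  passes from square integrability to integrability.\<close>

lemma L2_loc_integrable_on_compact:
  assumes g: "L2_loc g" and K: "compact K"
  shows "set_integrable lborel K g"
  unfolding set_integrable_def
proof (rule Bochner_Integration.integrable_bound)
  have "emeasure lborel K < \<infinity>" using emeasure_bounded_finite[OF compact_imp_bounded[OF K]] by (simp add: top.not_eq_extremum)
  then have "set_integrable lborel K (\<lambda>_. 1 :: real)"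
    using K by (simp add: set_integrable_def compact_imp_closed borel_closed)
  from set_integral_add(1)[OF this L2_locD(2)[OF g K]]
  show "integrable lborel (\<lambda>z. indicator K z *\<^sub>R (1 + (norm (g z))\<^sup>2))"
    by (simp add: set_integrable_def)
  have "norm (g z) \<le> 1 + (norm (g z))\<^sup>2" for z
    using sum_squares_bound[of 1 "norm (g z)"] norm_ge_zero[of "g z"] unfolding power_one by linarith
  then show "AE z in lborel. norm (indicator K z *\<^sub>R g z) \<le> norm (indicator K z *\<^sub>R (1 + (norm (g z))\<^sup>2))"
    by (auto simp: indicator_def intro!: always_eventually)
  show "(\<lambda>z. indicator K z *\<^sub>R g z) \<in> borel_measurable lborel"
    using L2_locD(1)[OF g] K by (auto simp: compact_imp_closed borel_closed)
qed

lemma test_function_integrable: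
  assumes \<phi>: "test_function \<phi>" and g: "L2_loc g"
  shows "integrable lborel (\<lambda>z. \<phi> z *\<^sub>R g z)"
proof -
  obtain r where r: "\<And>z. r < norm z \<Longrightarrow> \<phi> z = 0" using test_function_support[OF \<phi>] by blast
  obtain C where C: "\<And>z. \<bar>\<phi> z\<bar> \<le> C" using test_function_bounded[OF \<phi>] by blast
  have "0 \<le> C" using C[of 0] by linarith
  show ?thesis
  proof (rule Bochner_Integration.integrable_bound)
    show "integrable lborel (\<lambda>z. C *\<^sub>R (indicator (cball 0 r) z *\<^sub>R g z))"
      using L2_loc_integrable_on_compact[OF g, of "cball 0 r"]
      by (intro integrable_scaleR_right) (simp add: set_integrable_def)
    have "norm (\<phi> z *\<^sub>R g z) \<le> norm (C *\<^sub>R (indicator (cball 0 r) z *\<^sub>R g z))" for z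
      using r[of z] C[of z] \<open>0 \<le> C\<close> by (cases "norm z \<le> r") (auto intro: mult_right_mono)
    then show "AE z in lborel. norm (\<phi> z *\<^sub>R g z) \<le> norm (C *\<^sub>R (indicator (cball 0 r) z *\<^sub>R g z))" by simp
    show "(\<lambda>z. \<phi> z *\<^sub>R g z) \<in> borel_measurable lborel"
      using L2_locD(1)[OF g] test_function_measurable[OF \<phi>] by simp
  qed
qed

text \<open>Box bumps are test functions that converge to the indicator of a box and are dominated
  by that of the closed box, so \<open>g\<close> has integral 0 over every box.\<close>

lemma fundamental_lemma:
  assumes g: "L2_loc g" and zero: "\<And>\<phi>. test_function \<phi> \<Longrightarrow> (LINT z|lborel. \<phi> z *\<^sub>R g z) = 0"
  shows "AE z in lborel. g z = 0"
proof -
  have [measurable]: "g \<in> borel_measurable borel" by (rule L2_locD(1)[OF g])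
  have box0: "(LINT z:box l u|lborel. g z) = 0" for l u
  proof -
    have "(\<lambda>n. LINT z|lborel. box_bump l u n z *\<^sub>R g z) \<longlonglongrightarrow> (LINT z|lborel. indicator (box l u) z *\<^sub>R g z)"
    proof (rule integral_dominated_convergence)
      show "integrable lborel (\<lambda>z. norm (indicator (cbox l u) z *\<^sub>R g z))"
        using L2_loc_integrable_on_compact[OF g, of "cbox l u"]
        by (intro integrable_norm) (simp add: set_integrable_def)
      show "AE z in lborel. (\<lambda>n. box_bump l u n z *\<^sub>R g z) \<longlonglongrightarrow> indicator (box l u) z *\<^sub>R g z"
        by (intro always_eventually allI tendsto_scaleR box_bump_tendsto tendsto_const)
      have "norm (box_bump l u n z *\<^sub>R g z) \<le> norm (indicator (cbox l u) z *\<^sub>R g z)" for n z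
      proof (cases "z \<in> box l u")
      case True
      then have "z \<in> cbox l u" using box_subset_cbox by blast
      with mult_right_mono[OF box_bump_range norm_ge_zero[of "g z"], of l u n z] show ?thesis by simp
    qed (simp add: box_bump_outside)
      then show "AE z in lborel. norm (box_bump l u n z *\<^sub>R g z) \<le> norm (indicator (cbox l u) z *\<^sub>R g z)" for n
        by simp
    qed (use test_function_measurable[OF test_function_box_bump] in measurable)
    then show ?thesis
      by (simp add: zero[OF test_function_box_bump] LIMSEQ_const_iff set_lebesgue_integral_def)
  qed
  \<comment> \<open>\<open>g\<close> is only locally integrable, so the criterion for integrable
    functions is applied to its truncations to large boxes; an intersection of two boxes is a
    box.\<close>
  have "AE z in lborel. indicator (box (- (real n *\<^sub>R One)) (real n *\<^sub>R One)) z *\<^sub>R g z = 0" for n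
  proof (rule AE_eq_0_if_integral_box_eq_0)
    let ?b = "box (- (real n *\<^sub>R One)) (real n *\<^sub>R One) :: complex set"
    have "set_integrable lborel (cbox (- (real n *\<^sub>R One)) (real n *\<^sub>R One)) g"
      by (rule L2_loc_integrable_on_compact[OF g compact_cbox])
    from set_integrable_subset[OF this _ box_subset_cbox]
    show "integrable lborel (\<lambda>z. indicator ?b z *\<^sub>R g z)" by (simp add: set_integrable_def)
    show "(LINT z:box l u|lborel. indicator ?b z *\<^sub>R g z) = 0" for l u
    proof -
      obtain l' u' where "box l u \<inter> ?b = box l' u'" unfolding box_Int_box by blast
      with box0[of l' u'] show ?thesis
        by (simp add: set_lebesgue_integral_def indicator_inter_arith[symmetric])
    qed
  qed
  then have "AE z in lborel. \<forall>n. indicator (box (- (real n *\<^sub>R One)) (real n *\<^sub>R One)) z *\<^sub>R g z = 0"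
    unfolding AE_all_countable ..
  then show ?thesis
  proof eventually_elim
    fix z assume *: "\<forall>n. indicator (box (- (real n *\<^sub>R One)) (real n *\<^sub>R One)) z *\<^sub>R g z = 0"
    have "z \<in> (\<Union>n. box (- (real n *\<^sub>R One)) (real n *\<^sub>R One))" unfolding UN_box_eq_UNIV by simp
    then obtain n where "z \<in> box (- (real n *\<^sub>R One)) (real n *\<^sub>R One)" by blast
    with *[rule_format, of n] show "g z = 0" by simp
  qed
qed

subsection \<open>Weak derivatives\<close>

lemma norm_add_squared_le: "(norm (a + b))\<^sup>2 \<le> 2 * (norm a)\<^sup>2 + 2 * (norm b)\<^sup>2"
  for a b :: "'a::real_normed_vector"
proof -
  have "(norm (a + b))\<^sup>2 \<le> (norm a + norm b)\<^sup>2" by (intro power_mono norm_triangle_ineq) simp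
  also have "\<dots> \<le> 2 * (norm a)\<^sup>2 + 2 * (norm b)\<^sup>2"
    using sum_squares_bound[of "norm a" "norm b"] by (simp add: power2_sum)
  finally show ?thesis .
qed

lemma L2_loc_diff:
  assumes f: "L2_loc f" and g: "L2_loc g"
  shows "L2_loc (\<lambda>z. f z - g z)"
  unfolding L2_loc_def
proof (intro conjI allI impI)
  note [measurable] = L2_locD(1)[OF f] L2_locD(1)[OF g]
  show "(\<lambda>z. f z - g z) \<in> borel_measurable lborel" by simp
  fix K :: "complex set" assume K: "compact K"
  then have [measurable]: "K \<in> sets borel" by (simp add: compact_imp_closed borel_closed)
  have "set_integrable lborel K (\<lambda>z. 2 * (norm (f z))\<^sup>2 + 2 * (norm (g z))\<^sup>2)"
    by (intro set_integral_add(1) set_integrable_mult_right L2_locD(2) f g K)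
  moreover have "(norm (f z - g z))\<^sup>2 \<le> 2 * (norm (f z))\<^sup>2 + 2 * (norm (g z))\<^sup>2" for z
    using norm_add_squared_le[of "f z" "- g z"] by simp
  ultimately show "set_integrable lborel K (\<lambda>z. (norm (f z - g z))\<^sup>2)"
    unfolding set_integrable_def
    by (elim Bochner_Integration.integrable_bound) (auto simp: indicator_def)
qed

lemma L2_loc_bounded:
  assumes [measurable]: "f \<in> borel_measurable borel" and C: "\<And>z. norm (f z) \<le> C"
  shows "L2_loc f"
  unfolding L2_loc_def
proof (intro conjI allI impI)
  show "f \<in> borel_measurable lborel" by simp
  fix K :: "complex set" assume K: "compact K"
  then have [measurable]: "K \<in> sets borel" by (simp add: compact_imp_closed borel_closed)
  have "emeasure lborel K < \<infinity>"
    using emeasure_bounded_finite[OF compact_imp_bounded[OF K]] by (simp add: top.not_eq_extremum)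
  then have "integrable lborel (\<lambda>z. indicator K z *\<^sub>R C\<^sup>2)" by simp
  moreover have "(norm (f z))\<^sup>2 \<le> C\<^sup>2" for z by (intro power_mono C) simp
  ultimately show "set_integrable lborel K (\<lambda>z. (norm (f z))\<^sup>2)"
    unfolding set_integrable_def
    by (elim Bochner_Integration.integrable_bound) (auto simp: indicator_def)
qed

lemma is_weak_partialD:
  assumes "is_weak_partial b u g"
  shows "L2_loc g" "g \<in> borel_measurable borel"
    "test_function \<phi> \<Longrightarrow> (LINT z|lborel. partial b \<phi> z *\<^sub>R u z) = - (LINT z|lborel. \<phi> z *\<^sub>R g z)"
  using assms L2_locD(1)[of g] by (simp_all add: is_weak_partial_def)

lemma is_weak_partial_diff:
  assumes b: "b \<in> Basis" and u: "L2_loc u" "is_weak_partial b u g" and v: "L2_loc v" "is_weak_partial b v k"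
  shows "is_weak_partial b (\<lambda>z. u z - v z) (\<lambda>z. g z - k z)"
  unfolding is_weak_partial_def
proof (intro conjI allI impI)
  show "L2_loc (\<lambda>z. g z - k z)"
    by (intro L2_loc_diff is_weak_partialD(1)[OF u(2)] is_weak_partialD(1)[OF v(2)])
  fix \<phi> assume \<phi>: "test_function \<phi>"
  note p = test_function_partial[OF \<phi> b]
  show "(LINT z|lborel. partial b \<phi> z *\<^sub>R (u z - v z)) = - (LINT z|lborel. \<phi> z *\<^sub>R (g z - k z))"
    unfolding scaleR_diff_right
    by (subst (1 2) Bochner_Integration.integral_diff)
      (auto intro!: test_function_integrable p u v \<phi> is_weak_partialD(1)[OF u(2)] is_weak_partialD(1)[OF v(2)]
        simp: is_weak_partialD(3)[OF u(2) \<phi>] is_weak_partialD(3)[OF v(2) \<phi>])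
qed

lemma weak_partial_AE_unique:
  assumes g: "is_weak_partial b u g" and k: "is_weak_partial b u k"
  shows "AE z in lborel. g z = k z"
proof -
  note L = is_weak_partialD(1)[OF g] is_weak_partialD(1)[OF k]
  have "AE z in lborel. g z - k z = 0"
  proof (rule fundamental_lemma[OF L2_loc_diff[OF L]])
    fix \<phi> assume \<phi>: "test_function \<phi>"
    show "(LINT z|lborel. \<phi> z *\<^sub>R (g z - k z)) = 0"
      unfolding scaleR_diff_right
      using is_weak_partialD(3)[OF g \<phi>] is_weak_partialD(3)[OF k \<phi>]
      by (subst Bochner_Integration.integral_diff) (auto intro!: test_function_integrable L \<phi>)
  qed
  then show ?thesis by simp
qed

lemma is_weak_partial_weak_partial: "is_weak_partial b u g \<Longrightarrow> is_weak_partial b u (weak_partial b u)"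
  unfolding weak_partial_def by (rule someI[of "is_weak_partial b u"])

section \<open>Weak derivatives of Lipschitz functions\<close>

lemma integral_lborel_translate:
  fixes f :: "'a::euclidean_space \<Rightarrow> 'b::{banach, second_countable_topology}"
  assumes [measurable]: "f \<in> borel_measurable borel"
  shows "(LINT z|lborel. f (z + c)) = (LINT z|lborel. f z)"
proof -
  have "(LINT z|lborel. f z) = (LINT z|distr lborel borel ((+) c). f z)"
    by (simp only: lborel_distr_plus)
  then show ?thesis by (simp add: integral_distr add.commute)
qed

text \<open>Puts the derivative into the form of a limit of difference quotients, to which dominated
  convergence applies under the integral.\<close>

lemma has_vector_derivative_iff_quotient:
  "(f has_vector_derivative D) (at t) \<longleftrightarrow> ((\<lambda>h. (f (t + h) - f t) /\<^sub>R h) \<longlongrightarrow> D) (at 0)"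
proof -
  have "norm (f (t + h) - f t - h *\<^sub>R D) / norm h = norm ((f (t + h) - f t) /\<^sub>R h - D)" if "h \<noteq> 0" for h
  proof -
    have "(f (t + h) - f t) /\<^sub>R h - D = (f (t + h) - f t - h *\<^sub>R D) /\<^sub>R h"
      using that by (simp add: scaleR_diff_right)
    then show ?thesis by (simp add: divide_inverse_commute)
  qed
  then have "((\<lambda>h. norm (f (t + h) - f t - h *\<^sub>R D) / norm h) \<longlongrightarrow> 0) (at 0)
      \<longleftrightarrow> ((\<lambda>h. norm ((f (t + h) - f t) /\<^sub>R h - D)) \<longlongrightarrow> 0) (at 0)"
    by (intro filterlim_cong refl) (auto simp: eventually_at_filter)
  then show ?thesis
    by (simp add: has_vector_derivative_def has_derivative_at bounded_linear_scaleR_left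
        tendsto_norm_zero_iff LIM_zero_iff)
qed

text \<open>Difference quotients have integral \<open>0\<close> by translation invariance and converge dominatedly;
  this replaces Fubini and a one-dimensional fundamental theorem in the integration by parts.\<close>

lemma lipschitz_integral_derivative_eq_0:
  fixes f :: "complex \<Rightarrow> complex"
  assumes lip: "\<And>z w. norm (f z - f w) \<le> L * norm (z - w)"
    and supp: "\<And>z. r < norm z \<Longrightarrow> f z = 0"
    and g [measurable]: "g \<in> borel_measurable borel"
    and deriv: "AE z in lborel. ((\<lambda>t. f (z + t *\<^sub>R b)) has_vector_derivative g z) (at 0)"
  shows "(LINT z|lborel. g z) = 0"
proof -
  have "0 \<le> L" using lip[of 1 0] norm_ge_zero[of "f 1 - f 0"] by (simp del: norm_ge_zero)
  have "L-lipschitz_on UNIV f"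
    using lip \<open>0 \<le> L\<close> by (auto simp: lipschitz_on_def dist_norm)
  then have cf: "continuous_on UNIV f" by (rule lipschitz_on_continuous_on)
  have [measurable]: "f \<in> borel_measurable borel" by (rule borel_measurable_continuous_onI[OF cf])
  have fint: "integrable lborel f"
  proof -
    have "set_integrable lborel (cball 0 r) f"
      unfolding set_integrable_def
      by (intro borel_integrable_compact continuous_on_subset[OF cf]) auto
    moreover have "(\<lambda>z. indicator (cball 0 r) z *\<^sub>R f z) = f"
      using supp by (auto simp: fun_eq_iff indicator_def not_le)
    ultimately show ?thesis by (simp only: set_integrable_def)
  qed
  define h where "h n = inverse (real (Suc n))" for n
  have h0: "h \<longlonglongrightarrow> 0" unfolding h_def by (rule LIMSEQ_inverse_real_of_nat)
  have hp: "0 < h n" "h n \<le> 1" for n by (auto simp: h_def field_simps)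
  define q where "q n z = (f (z + h n *\<^sub>R b) - f z) /\<^sub>R h n" for n z
  have q0: "(LINT z|lborel. q n z) = 0" for n
  proof -
    have "integrable lborel (\<lambda>z. f (z + h n *\<^sub>R b))"
    proof -
      have "integrable (distr lborel borel ((+) (h n *\<^sub>R b))) f"
        using fint by (simp only: lborel_distr_plus)
      then show ?thesis by (subst (asm) integrable_distr_eq) (auto simp: add.commute)
    qed
    then show ?thesis
      using fint by (simp add: q_def integral_lborel_translate)
  qed
  have "(\<lambda>n. LINT z|lborel. q n z) \<longlonglongrightarrow> (LINT z|lborel. g z)"
  proof (rule integral_dominated_convergence)
    show "g \<in> borel_measurable lborel" by simp
    show "q n \<in> borel_measurable lborel" for n unfolding q_def by simp
    \<comment> \<open>The increments \<open>h n\<close> are at most 1, so every quotient vanishes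
      outside the ball enlarged by \<open>norm b\<close>; inside it the Lipschitz constant gives the
      majorant.\<close>
    have "emeasure lborel (cball (0::complex) (r + norm b)) < \<infinity>"
      using emeasure_bounded_finite[OF bounded_cball] by (simp add: top.not_eq_extremum)
    then show "integrable lborel (\<lambda>z. indicator (cball (0::complex) (r + norm b)) z *\<^sub>R (L * norm b))"
      by (intro integrable_scaleR_left integrable_real_indicator) simp_all
    show "AE z in lborel. (\<lambda>n. q n z) \<longlonglongrightarrow> g z"
      using deriv
    proof eventually_elim
      fix z assume "((\<lambda>t. f (z + t *\<^sub>R b)) has_vector_derivative g z) (at 0)"
      then have "((\<lambda>t. (f (z + t *\<^sub>R b) - f z) /\<^sub>R t) \<longlongrightarrow> g z) (at 0)"
        by (simp add: has_vector_derivative_iff_quotient)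
      then show "(\<lambda>n. q n z) \<longlonglongrightarrow> g z"
        unfolding q_def
        by (rule filterlim_compose) (use h0 hp in \<open>auto simp: filterlim_at less_imp_neq[symmetric]\<close>)
    qed
    show "AE z in lborel. norm (q n z) \<le> indicator (cball 0 (r + norm b)) z *\<^sub>R (L * norm b)" for n
    proof (intro always_eventually allI)
      fix z
      have hb: "norm (h n *\<^sub>R b) \<le> norm b" using hp[of n] by (simp add: mult_left_le_one_le)
      show "norm (q n z) \<le> indicator (cball 0 (r + norm b)) z *\<^sub>R (L * norm b)"
      proof (cases "norm z \<le> r + norm b")
        case True
        have "norm (q n z) \<le> (L * norm (h n *\<^sub>R b)) / h n"
          using lip[of "z + h n *\<^sub>R b" z] hp[of n] by (simp add: q_def divide_right_mono divide_inverse_commute)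
        with True hp[of n] show ?thesis by simp
      next
        case False
        then have "r < norm z" using norm_ge_zero[of b] by linarith
        moreover have "r < norm (z + h n *\<^sub>R b)"
          using False hb norm_triangle_ineq4[of "z + h n *\<^sub>R b" "h n *\<^sub>R b"] by simp
        ultimately show ?thesis using \<open>0 \<le> L\<close> by (simp add: q_def supp)
      qed
    qed
  qed
  then show ?thesis by (simp add: q0 LIMSEQ_const_iff)
qed

text \<open>The product \<open>\<phi> u\<close> is Lipschitz with bounded support, so its derivative
  along \<open>b\<close> has integral 0; by the product rule this is integration by parts. The
  derivative of \<open>u\<close> is asked for almost everywhere, which admits a crease along a
  line.\<close>

lemma lipschitz_is_weak_partial:
  assumes lip: "\<And>z w. norm (u z - u w) \<le> L * norm (z - w)"
    and bounded: "\<And>z. norm (u z) \<le> C"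
    and g [measurable]: "g \<in> borel_measurable borel" and gb: "\<And>z. norm (g z) \<le> D"
    and deriv: "AE z in lborel. ((\<lambda>t. u (z + t *\<^sub>R b)) has_vector_derivative g z) (at 0)"
    and b: "b \<in> Basis"
  shows "is_weak_partial b u g"
  unfolding is_weak_partial_def
proof (intro conjI allI impI)
  show "L2_loc g" by (rule L2_loc_bounded[OF g gb])
  have "0 \<le> L" using lip[of 1 0] norm_ge_zero[of "u 1 - u 0"] by (simp del: norm_ge_zero)
  then have "L-lipschitz_on UNIV u" using lip by (auto simp: lipschitz_on_def dist_norm)
  then have [measurable]: "u \<in> borel_measurable borel"
    by (intro borel_measurable_continuous_onI lipschitz_on_continuous_on)
  have "L2_loc u" by (rule L2_loc_bounded[OF _ bounded]) simp
  fix \<phi> assume \<phi>: "test_function \<phi>"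
  note [measurable] = test_function_measurable[OF \<phi>] test_function_measurable[OF test_function_partial[OF \<phi> b]]
  obtain r where r: "\<And>z. r < norm z \<Longrightarrow> \<phi> z = 0" using test_function_support[OF \<phi>] by blast
  obtain M where M: "0 < M" "\<And>z. \<bar>\<phi> z\<bar> \<le> M" using test_function_bounded[OF \<phi>] by blast
  obtain N where N: "0 < N" "\<And>z w. \<bar>\<phi> z - \<phi> w\<bar> \<le> N * norm (z - w)" using test_function_lipschitz[OF \<phi>] by blast
  have "0 \<le> C" using bounded[of 0] norm_ge_zero[of "u 0"] by linarith
  have "(LINT z|lborel. \<phi> z *\<^sub>R g z + partial b \<phi> z *\<^sub>R u z) = 0"
  proof (rule lipschitz_integral_derivative_eq_0)
    show "norm (\<phi> z *\<^sub>R u z - \<phi> w *\<^sub>R u w) \<le> (M * L + N * C) * norm (z - w)" for z w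
    proof -
      have "\<phi> z *\<^sub>R u z - \<phi> w *\<^sub>R u w = \<phi> z *\<^sub>R (u z - u w) + (\<phi> z - \<phi> w) *\<^sub>R u w"
        by (simp add: algebra_simps)
      also have "norm \<dots> \<le> \<bar>\<phi> z\<bar> * norm (u z - u w) + \<bar>\<phi> z - \<phi> w\<bar> * norm (u w)"
        by (rule norm_triangle_le) simp
      also have "\<dots> \<le> M * (L * norm (z - w)) + (N * norm (z - w)) * C"
        using \<open>0 \<le> L\<close> M N by (intro add_mono mult_mono lip bounded) auto
      finally show ?thesis by (simp add: algebra_simps)
    qed
    show "r < norm z \<Longrightarrow> \<phi> z *\<^sub>R u z = 0" for z by (simp add: r)
    show "(\<lambda>z. \<phi> z *\<^sub>R g z + partial b \<phi> z *\<^sub>R u z) \<in> borel_measurable borel" by simp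
    show "AE z in lborel. ((\<lambda>t. \<phi> (z + t *\<^sub>R b) *\<^sub>R u (z + t *\<^sub>R b)) has_vector_derivative
        \<phi> z *\<^sub>R g z + partial b \<phi> z *\<^sub>R u z) (at 0)"
      using deriv
    proof eventually_elim
      fix z assume u: "((\<lambda>t. u (z + t *\<^sub>R b)) has_vector_derivative g z) (at 0)"
      from has_field_derivative_along[OF test_function_differentiable[OF \<phi>], where z = z and t = 0 and b = b]
      have "((\<lambda>t. \<phi> (z + t *\<^sub>R b)) has_real_derivative partial b \<phi> z) (at 0)" by simp
      from has_vector_derivative_scaleR[OF this u]
      show "((\<lambda>t. \<phi> (z + t *\<^sub>R b) *\<^sub>R u (z + t *\<^sub>R b)) has_vector_derivative
        \<phi> z *\<^sub>R g z + partial b \<phi> z *\<^sub>R u z) (at 0)" by simp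
    qed
  qed
  then show "(LINT z|lborel. partial b \<phi> z *\<^sub>R u z) = - (LINT z|lborel. \<phi> z *\<^sub>R g z)"
    by (subst (asm) Bochner_Integration.integral_add)
      (auto intro!: test_function_integrable \<phi> test_function_partial b \<open>L2_loc u\<close> \<open>L2_loc g\<close>
        simp: add_eq_0_iff2)
qed

text \<open>Every test function is multiplied by \<open>smooth_step (Im z)\<close>. The derivative
  of the product vanishes for \<open>Im z < 0\<close> and \<open>w\<close> vanishes elsewhere, so
  \<open>smooth_step (Im z) k\<close> is orthogonal to all test functions; the weight is positive
  for \<open>Im z > 0\<close>.\<close>

lemma weak_partial_eq_0_upper:
  assumes b: "b \<in> Basis" and k: "is_weak_partial b w k"
    and w0: "AE z in lborel. 0 \<le> Im z \<longrightarrow> w z = 0"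
  shows "AE z in lborel. 0 < Im z \<longrightarrow> k z = 0"
proof -
  have st: "Ck n (\<lambda>z. smooth_step (Im z))" for n by (rule Ck_smooth_step[OF Ck_Im])
  have [measurable]: "(\<lambda>z. smooth_step (Im z)) \<in> borel_measurable borel"
    using st[of 0] by (simp add: borel_measurable_continuous_onI)
  note [measurable] = is_weak_partialD(2)[OF k]
  have "AE z in lborel. smooth_step (Im z) *\<^sub>R k z = 0"
  proof (rule fundamental_lemma)
    have "\<bar>smooth_step t\<bar> \<le> 1" for t
      using smooth_step_nonneg[of t] smooth_step_le_1[of t] by simp
    then have le: "norm (smooth_step (Im z) *\<^sub>R k z) \<le> norm (k z)" for z
      by (simp add: mult_left_le_one_le)
    show "L2_loc (\<lambda>z. smooth_step (Im z) *\<^sub>R k z)"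
      unfolding L2_loc_def
    proof (intro conjI allI impI)
      fix K :: "complex set" assume K: "compact K"
      then have [measurable]: "K \<in> sets borel" by (simp add: compact_imp_closed borel_closed)
      show "set_integrable lborel K (\<lambda>z. (norm (smooth_step (Im z) *\<^sub>R k z))\<^sup>2)"
        using L2_locD(2)[OF is_weak_partialD(1)[OF k] K] unfolding set_integrable_def
        by (rule Bochner_Integration.integrable_bound)
          (use le in \<open>auto simp: indicator_def intro!: power_mono simp del: norm_scaleR\<close>)
    qed simp
    fix \<phi> assume \<phi>: "test_function \<phi>"
    define \<psi> where "\<psi> = (\<lambda>z. \<phi> z * smooth_step (Im z))"
    have \<psi>: "test_function \<psi>" unfolding \<psi>_def by (rule test_function_mult[OF \<phi> st])
    have "AE z in lborel. partial b \<psi> z *\<^sub>R w z = 0"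
      using w0
    proof eventually_elim
      fix z assume z: "0 \<le> Im z \<longrightarrow> w z = 0"
      show "partial b \<psi> z *\<^sub>R w z = 0"
      proof (cases "0 \<le> Im z")
        case False
        have "open {z. Im z < 0}" by (intro open_Collect_less continuous_intros)
        then have "partial b \<psi> z = 0"
          by (rule partial_eq_0_open) (use False in \<open>auto simp: \<psi>_def smooth_step_eq_0\<close>)
        then show ?thesis by simp
      qed (use z in simp)
    qed
    then have "(LINT z|lborel. partial b \<psi> z *\<^sub>R w z) = 0" by (rule integral_eq_zero_AE)
    with is_weak_partialD(3)[OF k \<psi>] show "(LINT z|lborel. \<phi> z *\<^sub>R smooth_step (Im z) *\<^sub>R k z) = 0"
      by (simp add: \<psi>_def)
  qed
  then show ?thesis
    by eventually_elim (use smooth_step_pos in \<open>force simp: less_imp_neq[symmetric]\<close>)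
qed

text \<open>The rotated gradient of a test function is divergence free.\<close>

lemma integral_curl_eq_0:
  assumes \<psi>: "test_function \<psi>" and k: "is_weak_partial 1 w k\<^sub>1" "is_weak_partial \<i> w k\<^sub>2"
  shows "(LINT z|lborel. partial \<i> \<psi> z *\<^sub>R k\<^sub>1 z) = (LINT z|lborel. partial 1 \<psi> z *\<^sub>R k\<^sub>2 z)"
proof -
  have B: "1 \<in> (Basis :: complex set)" "\<i> \<in> (Basis :: complex set)" by (auto simp: Basis_complex_def)
  have "partial 1 (partial \<i> \<psi>) = partial \<i> (partial 1 \<psi>)"
    using partial_commute[OF test_function_Ck[OF \<psi>] B(2,1)] by blast
  with is_weak_partialD(3)[OF k(1) test_function_partial[OF \<psi> B(2)]]
    is_weak_partialD(3)[OF k(2) test_function_partial[OF \<psi> B(1)]]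
  show ?thesis by simp
qed

text \<open>\<open>F s\<close> below tests \<open>w\<close> against a vertical translate of \<open>\<phi>\<close>: it is constant because
  \<open>\<partial>\<^sub>y w = 0\<close>, and vanishes once the support lies in the upper half-plane.\<close>

lemma AE_eq_0_if_weak_partial_eq_0:
  assumes w: "L2_loc w" and k: "is_weak_partial \<i> w (\<lambda>_. 0)"
    and w0: "AE z in lborel. 0 \<le> Im z \<longrightarrow> w z = 0"
  shows "AE z in lborel. w z = 0"
proof (rule fundamental_lemma[OF w])
  note [measurable] = L2_locD(1)[OF w]
  fix \<phi> assume \<phi>: "test_function \<phi>"
  note \<phi>' = test_function_translate[OF \<phi>]
  obtain r where r: "0 < r" "\<And>z. r < norm z \<Longrightarrow> \<phi> z = 0" using test_function_support[OF \<phi>] by blast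
  obtain N where N: "0 < N" "\<And>z w. \<bar>\<phi> z - \<phi> w\<bar> \<le> N * norm (z - w)" using test_function_lipschitz[OF \<phi>] by blast
  define F where "F s = (LINT z|lborel. \<phi> (z + s *\<^sub>R \<i>) *\<^sub>R w z)" for s
  have F': "(F has_vector_derivative 0) (at s)" for s
  proof -
    let ?Q = "\<lambda>t z. ((\<phi> (z + (s + t) *\<^sub>R \<i>) - \<phi> (z + s *\<^sub>R \<i>)) / t) *\<^sub>R w z"
    have pd: "partial \<i> (\<lambda>z. \<phi> (z + s *\<^sub>R \<i>)) z = partial \<i> \<phi> (z + s *\<^sub>R \<i>)" for z
      by (rule partial_translate) (rule test_function_differentiable[OF \<phi>])
    have "((\<lambda>t. (F (s + t) - F s) /\<^sub>R t) \<longlongrightarrow> 0) (at 0)"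
    proof (subst tendsto_at_iff_sequentially, intro allI impI)
      \<comment> \<open>Dominated convergence works along sequences. The bound \<open>B\<close> on
        the shifts yields one ball that contains the supports of all quotients, which matters
        because \<open>w\<close> is only locally integrable.\<close>
      fix X :: "nat \<Rightarrow> real" assume X: "\<forall>i. X i \<in> UNIV - {0}" "X \<longlonglongrightarrow> 0"
      from X(2) obtain B where B: "\<And>n. \<bar>X n\<bar> \<le> B"
        using convergent_imp_bounded[of X] by (auto simp: bounded_iff convergent_def)
      have B0: "0 \<le> B" using B[of 0] by linarith
      let ?K = "cball (0::complex) (r + \<bar>s\<bar> + B)"
      note [measurable] = test_function_measurable[OF \<phi>']
      have "(\<lambda>n. LINT z|lborel. ?Q (X n) z) \<longlonglongrightarrow> (LINT z|lborel. partial \<i> (\<lambda>z. \<phi> (z + s *\<^sub>R \<i>)) z *\<^sub>R w z)"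
      proof (rule integral_dominated_convergence)
        show "integrable lborel (\<lambda>z. N * norm (indicator ?K z *\<^sub>R w z))"
          using L2_loc_integrable_on_compact[OF w, of ?K]
          by (intro integrable_mult_right integrable_norm) (simp add: set_integrable_def)
        show "AE z in lborel. (\<lambda>n. ?Q (X n) z) \<longlonglongrightarrow> partial \<i> (\<lambda>z. \<phi> (z + s *\<^sub>R \<i>)) z *\<^sub>R w z"
        proof (intro always_eventually allI tendsto_scaleR tendsto_const)
          fix z
          have "((\<lambda>t. \<phi> (z + t *\<^sub>R \<i>)) has_real_derivative partial \<i> \<phi> (z + s *\<^sub>R \<i>)) (at s)"
            by (rule has_field_derivative_along) (rule test_function_differentiable[OF \<phi>])
          then have "((\<lambda>t. (\<phi> (z + (s + t) *\<^sub>R \<i>) - \<phi> (z + s *\<^sub>R \<i>)) / t) \<longlongrightarrow> partial \<i> \<phi> (z + s *\<^sub>R \<i>)) (at 0)"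
            by (simp only: DERIV_def)
          then have "(\<lambda>n. (\<phi> (z + (s + X n) *\<^sub>R \<i>) - \<phi> (z + s *\<^sub>R \<i>)) / X n) \<longlonglongrightarrow> partial \<i> \<phi> (z + s *\<^sub>R \<i>)"
            by (rule filterlim_compose) (use X in \<open>auto simp: filterlim_at\<close>)
          then show "(\<lambda>n. (\<phi> (z + (s + X n) *\<^sub>R \<i>) - \<phi> (z + s *\<^sub>R \<i>)) / X n) \<longlonglongrightarrow> partial \<i> (\<lambda>z. \<phi> (z + s *\<^sub>R \<i>)) z"
            by (simp only: pd)
        qed
        show "AE z in lborel. norm (?Q (X n) z) \<le> N * norm (indicator ?K z *\<^sub>R w z)" for n
        proof (intro always_eventually allI)
          fix z
          show "norm (?Q (X n) z) \<le> N * norm (indicator ?K z *\<^sub>R w z)"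
          proof (cases "z \<in> ?K")
            case True
            have "\<bar>\<phi> (z + (s + X n) *\<^sub>R \<i>) - \<phi> (z + s *\<^sub>R \<i>)\<bar> \<le> N * norm (X n *\<^sub>R \<i>)"
              using N(2)[of "z + (s + X n) *\<^sub>R \<i>" "z + s *\<^sub>R \<i>"] by (simp add: algebra_simps)
            moreover have "X n \<noteq> 0" using X by auto
            ultimately have "\<bar>(\<phi> (z + (s + X n) *\<^sub>R \<i>) - \<phi> (z + s *\<^sub>R \<i>)) / X n\<bar> \<le> N"
              by (simp add: field_simps)
            from mult_right_mono[OF this norm_ge_zero[of "w z"]] True show ?thesis by simp
          next
            case False
            then have z: "r + \<bar>s\<bar> + B < norm z" by simp
            have "r < norm (z + t *\<^sub>R \<i>)" if "\<bar>t\<bar> \<le> \<bar>s\<bar> + B" for t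
            proof -
              have "norm z \<le> norm (z + t *\<^sub>R \<i>) + norm (t *\<^sub>R \<i>)"
                using norm_triangle_ineq4[of "z + t *\<^sub>R \<i>" "t *\<^sub>R \<i>"] by simp
              with z that show ?thesis by simp
            qed
            then have "\<phi> (z + t *\<^sub>R \<i>) = 0" if "\<bar>t\<bar> \<le> \<bar>s\<bar> + B" for t using r(2) that by blast
            from this[of s] this[of "s + X n"] B[of n] B0 N(1) show ?thesis
              using abs_triangle_ineq[of s "X n"] by simp
          qed
        qed
      qed (auto simp: Basis_complex_def intro!: borel_measurable_scaleR borel_measurable_divide borel_measurable_diff \<phi>' test_function_measurable test_function_partial)
      also have "(LINT z|lborel. partial \<i> (\<lambda>z. \<phi> (z + s *\<^sub>R \<i>)) z *\<^sub>R w z) = 0"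
        using is_weak_partialD(3)[OF k \<phi>', of "s *\<^sub>R \<i>"] by simp
      also have "(\<lambda>n. LINT z|lborel. ?Q (X n) z) = (\<lambda>n. (F (s + X n) - F s) /\<^sub>R X n)"
      proof
        fix n
        have "?Q (X n) z = (\<phi> (z + (s + X n) *\<^sub>R \<i>) *\<^sub>R w z - \<phi> (z + s *\<^sub>R \<i>) *\<^sub>R w z) /\<^sub>R X n" for z
          by (simp add: divide_inverse_commute scaleR_diff_left scaleR_diff_right right_diff_distrib)
        then show "(LINT z|lborel. ?Q (X n) z) = (F (s + X n) - F s) /\<^sub>R X n"
          by (simp add: F_def test_function_integrable[OF \<phi>' w])
      qed
      finally show "((\<lambda>t. (F (s + t) - F s) /\<^sub>R t) \<circ> X) \<longlonglongrightarrow> 0" by (simp add: o_def)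
    qed
    then show ?thesis by (simp add: has_vector_derivative_iff_quotient)
  qed
  \<comment> \<open>With this shift \<open>\<phi> (z + s *\<^sub>R \<i>)\<close> can be nonzero only
    for \<open>Im z \<ge> 1\<close>.\<close>
  define s where "s = - r - 1"
  have "F 0 = F s"
    using has_vector_derivative_zero_constant[of UNIV F] F' by (metis UNIV_I convex_UNIV)
  also have "F s = 0"
    unfolding F_def
  proof (rule integral_eq_zero_AE)
    show "AE z in lborel. \<phi> (z + s *\<^sub>R \<i>) *\<^sub>R w z = 0"
      using w0
    proof eventually_elim
      fix z assume z: "0 \<le> Im z \<longrightarrow> w z = 0"
      show "\<phi> (z + s *\<^sub>R \<i>) *\<^sub>R w z = 0"
      proof (cases "0 \<le> Im z")
        case False
        then have "r < \<bar>Im (z + s *\<^sub>R \<i>)\<bar>" using r(1) by (simp add: s_def)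
        also have "\<dots> \<le> norm (z + s *\<^sub>R \<i>)" by (rule abs_Im_le_cmod)
        finally show ?thesis by (simp add: r(2))
      qed (use z in simp)
    qed
  qed
  finally show "(LINT z|lborel. \<phi> z *\<^sub>R w z) = 0" by (simp add: F_def)
qed

subsection \<open>Explicit integrals\<close>

lemma measurable_Complex [measurable]:
  "(\<lambda>p. Complex (fst p) (snd p)) \<in> borel_measurable (borel \<Otimes>\<^sub>M borel)"
  by (subst borel_prod, intro borel_measurable_continuous_onI) (auto intro!: continuous_intros)

text \<open>Opens the plane to Fubini: a Borel measure that gives every box its volume is Lebesgue
  measure, and the image of a product of intervals is a box.\<close>

lemma distr_lborel_Complex:
  "distr (lborel \<Otimes>\<^sub>M lborel) borel (\<lambda>p. Complex (fst p) (snd p)) = lborel"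
proof (rule lborel_eqI[symmetric])
  fix l u :: complex assume le: "\<And>b. b \<in> Basis \<Longrightarrow> l \<bullet> b \<le> u \<bullet> b"
  have le': "Re l \<le> Re u" "Im l \<le> Im u"
    using le[of 1] le[of \<i>] by (auto simp: Basis_complex_def)
  have "(\<lambda>p. Complex (fst p) (snd p)) -` box l u = {Re l<..<Re u} \<times> {Im l<..<Im u}"
    by (auto simp: box_def Basis_complex_def)
  then have "emeasure (distr (lborel \<Otimes>\<^sub>M lborel) borel (\<lambda>p. Complex (fst p) (snd p))) (box l u)
      = emeasure (lborel \<Otimes>\<^sub>M lborel) ({Re l<..<Re u} \<times> {Im l<..<Im u})"
    by (subst emeasure_distr) (simp_all add: space_pair_measure)
  also have "\<dots> = ennreal (Re u - Re l) * ennreal (Im u - Im l)"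
    using le' by (subst lborel.emeasure_pair_measure_Times) auto
  also have "\<dots> = (\<Prod>b\<in>Basis. (u - l) \<bullet> b)"
    using le' by (simp add: Basis_complex_def ennreal_mult)
  finally show "emeasure (distr (lborel \<Otimes>\<^sub>M lborel) borel (\<lambda>p. Complex (fst p) (snd p))) (box l u)
      = (\<Prod>b\<in>Basis. (u - l) \<bullet> b)" .
qed simp

lemma nn_integral_lborel_Complex:
  assumes [measurable]: "f \<in> borel_measurable borel"
  shows "(\<integral>\<^sup>+z. f z \<partial>lborel) = (\<integral>\<^sup>+y. \<integral>\<^sup>+x. f (Complex x y) \<partial>lborel \<partial>lborel)"
proof -
  have "(\<integral>\<^sup>+z. f z \<partial>lborel) = (\<integral>\<^sup>+p. f (Complex (fst p) (snd p)) \<partial>(lborel \<Otimes>\<^sub>M lborel))"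
    by (subst distr_lborel_Complex[symmetric], subst nn_integral_distr) auto
  also have "\<dots> = (\<integral>\<^sup>+y. \<integral>\<^sup>+x. f (Complex x y) \<partial>lborel \<partial>lborel)"
    by (subst lborel_pair.nn_integral_snd[symmetric]) auto
  finally show ?thesis .
qed

lemma nn_integral_FTC_UNIV:
  fixes f F :: "real \<Rightarrow> real"
  assumes F: "\<And>x. DERIV F x :> f x" and f: "\<And>x. isCont f x" and nonneg: "\<And>x. 0 \<le> f x"
    and lim: "(F \<longlongrightarrow> A) at_bot" "(F \<longlongrightarrow> B) at_top"
  shows "(\<integral>\<^sup>+x. ennreal (f x) \<partial>lborel) = ennreal (B - A)"
proof -
  have l: "((F \<circ> real_of_ereal) \<longlongrightarrow> A) (at_right (-\<infinity>))" "((F \<circ> real_of_ereal) \<longlongrightarrow> B) (at_left \<infinity>)"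
    using lim by (simp_all add: ereal_tendsto_simps)
  have "set_integrable lborel (einterval (-\<infinity>) \<infinity>) f" "(LBINT x=-\<infinity>..\<infinity>. f x) = B - A"
    by (rule interval_integral_FTC_nonneg[OF _ F f _ l]; simp add: nonneg)+
  then have "integrable lborel f" "(LINT x|lborel. f x) = B - A"
    by (simp_all add: set_integrable_def interval_lebesgue_integral_def set_lebesgue_integral_def)
  then show ?thesis using nonneg by (simp add: nn_integral_eq_integral)
qed

text \<open>The odd primitive of \<open>1 / (x^2 + s^2)^2\<close>, from the reduction formula that
  lowers the exponent 2 to 1 and ends in an arctangent.\<close>

definition quartic_primitive :: "real \<Rightarrow> real \<Rightarrow> real" where
  "quartic_primitive s x = x / (2 * s\<^sup>2 * (x\<^sup>2 + s\<^sup>2)) + arctan (x / s) / (2 * s ^ 3)"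

lemma DERIV_quartic_primitive:
  assumes "0 < s"
  shows "DERIV (quartic_primitive s) x :> 1 / (x\<^sup>2 + s\<^sup>2)\<^sup>2"
proof -
  have "0 < x\<^sup>2 + s\<^sup>2" using assms by (simp add: add_nonneg_pos)
  then have ne: "x\<^sup>2 + s\<^sup>2 \<noteq> 0" "s \<noteq> 0" using assms by auto
  have "DERIV (\<lambda>x. arctan (x / s)) x :> inverse (1 + (x / s)\<^sup>2) * (1 / s)"
    by (rule DERIV_chain2[OF DERIV_arctan DERIV_cdivide[OF DERIV_ident]])
  also have "inverse (1 + (x / s)\<^sup>2) * (1 / s) = s / (x\<^sup>2 + s\<^sup>2)"
    using ne by (simp add: field_simps power2_eq_square)
  finally have A: "DERIV (\<lambda>x. arctan (x / s)) x :> s / (x\<^sup>2 + s\<^sup>2)" .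
  have R: "DERIV (\<lambda>x. x / (2 * s\<^sup>2 * (x\<^sup>2 + s\<^sup>2))) x :>
      (2 * s\<^sup>2 * (x\<^sup>2 + s\<^sup>2) - x * (2 * s\<^sup>2 * (2 * x))) / (2 * s\<^sup>2 * (x\<^sup>2 + s\<^sup>2))\<^sup>2"
    using ne by (auto intro!: derivative_eq_intros simp: power2_eq_square)
  have "DERIV (quartic_primitive s) x :> (2 * s\<^sup>2 * (x\<^sup>2 + s\<^sup>2) - x * (2 * s\<^sup>2 * (2 * x)))
      / (2 * s\<^sup>2 * (x\<^sup>2 + s\<^sup>2))\<^sup>2 + (s / (x\<^sup>2 + s\<^sup>2)) / (2 * s ^ 3)"
    unfolding quartic_primitive_def by (intro DERIV_add DERIV_cdivide A R)
  also have "(2 * s\<^sup>2 * (x\<^sup>2 + s\<^sup>2) - x * (2 * s\<^sup>2 * (2 * x)))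
      / (2 * s\<^sup>2 * (x\<^sup>2 + s\<^sup>2))\<^sup>2 + (s / (x\<^sup>2 + s\<^sup>2)) / (2 * s ^ 3) = 1 / (x\<^sup>2 + s\<^sup>2)\<^sup>2"
    using ne by (simp add: divide_simps) algebra
  finally show ?thesis .
qed

lemma quartic_primitive_tendsto:
  assumes "0 < s"
  shows "(quartic_primitive s \<longlongrightarrow> - (pi / (4 * s ^ 3))) at_bot" "(quartic_primitive s \<longlongrightarrow> pi / (4 * s ^ 3)) at_top"
  unfolding quartic_primitive_def using assms by (real_asymp simp: field_simps)+

lemma nn_integral_inverse_quartic:
  assumes "0 < s"
  shows "(\<integral>\<^sup>+x. ennreal (8 / (x\<^sup>2 + s\<^sup>2)\<^sup>2) \<partial>lborel) = ennreal (4 * pi / s ^ 3)"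
proof -
  have p: "0 < x\<^sup>2 + s\<^sup>2" for x using assms by (simp add: add_nonneg_pos)
  have "(\<integral>\<^sup>+x. ennreal (8 / (x\<^sup>2 + s\<^sup>2)\<^sup>2) \<partial>lborel)
      = ennreal (8 * (pi / (4 * s ^ 3)) - 8 * (- (pi / (4 * s ^ 3))))"
  proof (rule nn_integral_FTC_UNIV)
    show "DERIV (\<lambda>x. 8 * quartic_primitive s x) x :> 8 / (x\<^sup>2 + s\<^sup>2)\<^sup>2" for x
      using DERIV_cmult[OF DERIV_quartic_primitive[OF assms], of 8] by simp
    show "isCont (\<lambda>x. 8 / (x\<^sup>2 + s\<^sup>2)\<^sup>2) x" for x
      using p[of x] by (intro continuous_intros) auto
  qed (intro tendsto_intros quartic_primitive_tendsto assms | simp)+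
  then show ?thesis by simp
qed

text \<open>With \<open>s^2 = 1 + y^2\<close> this is the density
  \<open>8 |z|^2 / (1 + |z|^2)^3\<close> along the line at height \<open>y\<close>. In terms of
  \<open>Q = x^2 + s^2\<close> the integrand is \<open>8 (1 / Q^2 - 1 / Q^3)\<close>; the hypothesis
  on \<open>s\<close> makes it nonnegative.\<close>

lemma nn_integral_exchange_line:
  assumes "1 \<le> s"
  shows "(\<integral>\<^sup>+x. ennreal (8 * (x\<^sup>2 + s\<^sup>2 - 1) / (x\<^sup>2 + s\<^sup>2) ^ 3) \<partial>lborel)
    = ennreal (4 * pi / s ^ 3 - 3 * pi / s ^ 5)"
proof -
  have s: "0 < s" using assms by simp
  let ?A = "quartic_primitive s"
  \<comment> \<open>The bracket is the reduction formula for \<open>1 / (x^2 + s^2)^3\<close>,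
    lowering the exponent 3 to 2. \<open>F\<close> is odd, so its limits at both ends are
    opposite.\<close>
  define F where "F x = 8 * ?A x - 8 * (x / (4 * s\<^sup>2 * (x\<^sup>2 + s\<^sup>2)\<^sup>2) + 3 * ?A x / (4 * s\<^sup>2))" for x
  have p: "0 < x\<^sup>2 + s\<^sup>2" for x using assms by (simp add: add_nonneg_pos)
  let ?c = "2 * pi / s ^ 3 - 3 * pi / (2 * s ^ 5)"
  have "(\<integral>\<^sup>+x. ennreal (8 * (x\<^sup>2 + s\<^sup>2 - 1) / (x\<^sup>2 + s\<^sup>2) ^ 3) \<partial>lborel) = ennreal (?c - (- ?c))"
  proof (rule nn_integral_FTC_UNIV)
    show "DERIV F x :> 8 * (x\<^sup>2 + s\<^sup>2 - 1) / (x\<^sup>2 + s\<^sup>2) ^ 3" for x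
    proof -
      have ne: "x\<^sup>2 + s\<^sup>2 \<noteq> 0" "s \<noteq> 0" using p[of x] assms by auto
      note A = DERIV_quartic_primitive[OF s]
      have B: "DERIV (\<lambda>x. x / (4 * s\<^sup>2 * (x\<^sup>2 + s\<^sup>2)\<^sup>2)) x :>
          (4 * s\<^sup>2 * (x\<^sup>2 + s\<^sup>2)\<^sup>2 - x * (4 * s\<^sup>2 * (2 * (x\<^sup>2 + s\<^sup>2) * (2 * x)))) / (4 * s\<^sup>2 * (x\<^sup>2 + s\<^sup>2)\<^sup>2)\<^sup>2"
        using ne by (auto intro!: derivative_eq_intros simp: power2_eq_square)
      have "DERIV F x :> 8 * (1 / (x\<^sup>2 + s\<^sup>2)\<^sup>2) - 8 * ((4 * s\<^sup>2 * (x\<^sup>2 + s\<^sup>2)\<^sup>2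
          - x * (4 * s\<^sup>2 * (2 * (x\<^sup>2 + s\<^sup>2) * (2 * x)))) / (4 * s\<^sup>2 * (x\<^sup>2 + s\<^sup>2)\<^sup>2)\<^sup>2
          + 3 * (1 / (x\<^sup>2 + s\<^sup>2)\<^sup>2) / (4 * s\<^sup>2))"
        unfolding F_def by (intro DERIV_diff DERIV_cmult DERIV_add DERIV_cdivide A B)
      moreover have "8 * (1 / (x\<^sup>2 + s\<^sup>2)\<^sup>2) - 8 * ((4 * s\<^sup>2 * (x\<^sup>2 + s\<^sup>2)\<^sup>2
          - x * (4 * s\<^sup>2 * (2 * (x\<^sup>2 + s\<^sup>2) * (2 * x)))) / (4 * s\<^sup>2 * (x\<^sup>2 + s\<^sup>2)\<^sup>2)\<^sup>2
          + 3 * (1 / (x\<^sup>2 + s\<^sup>2)\<^sup>2) / (4 * s\<^sup>2)) = 8 * (x\<^sup>2 + s\<^sup>2 - 1) / (x\<^sup>2 + s\<^sup>2) ^ 3"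
        using ne by (simp add: divide_simps) algebra
      ultimately show ?thesis by simp
    qed
    show "isCont (\<lambda>x. 8 * (x\<^sup>2 + s\<^sup>2 - 1) / (x\<^sup>2 + s\<^sup>2) ^ 3) x" for x
      using p[of x] by (intro continuous_intros) auto
    have "1 \<le> s\<^sup>2" using assms by simp
    then have "1 \<le> x\<^sup>2 + s\<^sup>2" for x :: real using zero_le_power2[of x] by linarith
    then show "0 \<le> 8 * (x\<^sup>2 + s\<^sup>2 - 1) / (x\<^sup>2 + s\<^sup>2) ^ 3" for x
      by (intro divide_nonneg_nonneg mult_nonneg_nonneg zero_le_power less_imp_le[OF p]) simp_all
    note quartic_primitive_tendsto[OF s]
    moreover have "((\<lambda>x. x / (4 * s\<^sup>2 * (x\<^sup>2 + s\<^sup>2)\<^sup>2)) \<longlongrightarrow> 0) at_bot"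
      "((\<lambda>x. x / (4 * s\<^sup>2 * (x\<^sup>2 + s\<^sup>2)\<^sup>2)) \<longlongrightarrow> 0) at_top"
      using s by real_asymp+
    ultimately have
      "(F \<longlongrightarrow> 8 * (- (pi / (4 * s ^ 3))) - 8 * (0 + 3 * (- (pi / (4 * s ^ 3))) / (4 * s\<^sup>2))) at_bot"
      "(F \<longlongrightarrow> 8 * (pi / (4 * s ^ 3)) - 8 * (0 + 3 * (pi / (4 * s ^ 3)) / (4 * s\<^sup>2))) at_top"
      unfolding F_def by (intro tendsto_intros; use s in simp)+
    moreover have "8 * (pi / (4 * s ^ 3)) - 8 * (0 + 3 * (pi / (4 * s ^ 3)) / (4 * s\<^sup>2)) = ?c"
      using s by (simp add: field_simps power_numeral_reduce)
    ultimately show "(F \<longlongrightarrow> - ?c) at_bot" "(F \<longlongrightarrow> ?c) at_top" by simp_all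
  qed
  then show ?thesis by (simp add: field_simps)
qed

lemma nn_integral_exchange:
  "(\<integral>\<^sup>+z. ennreal (8 * (norm (z::complex))\<^sup>2 / (1 + (norm z)\<^sup>2) ^ 3) \<partial>lborel) = ennreal (4 * pi)"
proof -
  \<comment> \<open>The substitution \<open>y = tan \<theta>\<close>, with
    \<open>q = sin \<theta>\<close>. For \<open>s = sqrt (1 + y^2)\<close> it gives
    \<open>q' = 1 / s^3\<close> and \<open>1 - q^2 = 1 / s^2\<close>, so the integrand
    \<open>4 pi / s^3 - 3 pi / s^5\<close> is \<open>(pi + 3 pi q^2) q'\<close> and has the
    primitive \<open>pi q + pi q^3\<close>.\<close>
  define q where "q y = y / sqrt (1 + y\<^sup>2)" for y :: real
  have p: "0 < 1 + y\<^sup>2" for y :: real by (simp add: add_pos_nonneg)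
  let ?f = "\<lambda>y::real. 4 * pi / sqrt (1 + y\<^sup>2) ^ 3 - 3 * pi / sqrt (1 + y\<^sup>2) ^ 5"
  have "(\<integral>\<^sup>+z. ennreal (8 * (norm (z::complex))\<^sup>2 / (1 + (norm z)\<^sup>2) ^ 3) \<partial>lborel)
      = (\<integral>\<^sup>+y. \<integral>\<^sup>+x. ennreal (8 * (x\<^sup>2 + (sqrt (1 + y\<^sup>2))\<^sup>2 - 1) / (x\<^sup>2 + (sqrt (1 + y\<^sup>2))\<^sup>2) ^ 3) \<partial>lborel \<partial>lborel)"
    by (subst nn_integral_lborel_Complex) (simp_all add: cmod_power2 less_imp_le[OF p] algebra_simps)
  also have "\<dots> = (\<integral>\<^sup>+y. ennreal (?f y) \<partial>lborel)"
    by (subst nn_integral_exchange_line) auto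
  also have "\<dots> = ennreal (2 * pi - (- (2 * pi)))"
  proof (rule nn_integral_FTC_UNIV)
    show "DERIV (\<lambda>y. pi * q y + pi * q y ^ 3) y :> ?f y" for y
    proof -
      define s where "s = sqrt (1 + y\<^sup>2)"
      have s: "0 < s" "s\<^sup>2 = 1 + y\<^sup>2" using p[of y] by (auto simp: s_def)
      have "DERIV (\<lambda>y. sqrt (1 + y\<^sup>2)) y :> y / s"
        using p[of y] by (auto intro!: derivative_eq_intros simp: s_def field_simps)
      then have "DERIV q y :> (1 * s - y * (y / s)) / (s * s)"
        unfolding q_def s_def using p[of y] by (intro DERIV_divide DERIV_ident) auto
      also have "(1 * s - y * (y / s)) / (s * s) = 1 / s ^ 3"
        using s by (simp add: divide_simps) algebra
      finally have "DERIV (\<lambda>y. pi * q y + pi * q y ^ 3) y :> pi * (1 / s ^ 3) + pi * (3 * (1 / s ^ 3 * q y ^ 2))"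
        by (auto intro!: derivative_eq_intros)
      also have "pi * (1 / s ^ 3) + pi * (3 * (1 / s ^ 3 * q y ^ 2)) = ?f y"
        unfolding q_def s_def[symmetric] using s by (simp add: divide_simps) algebra
      finally show ?thesis .
    qed
    show "isCont ?f y" for y
      using p[of y] by (intro continuous_intros) auto
    show "0 \<le> ?f y" for y
    proof -
      define s where "s = sqrt (1 + y\<^sup>2)"
      have s: "1 \<le> s" "s \<noteq> 0" by (auto simp: s_def less_imp_neq[OF p, symmetric])
      then have "?f y = pi * (4 * s\<^sup>2 - 3) / s ^ 5"
        unfolding s_def[symmetric] by (simp add: field_simps power_numeral_reduce)
      moreover have "1 \<le> s\<^sup>2" using s by simp
      then have "0 \<le> 4 * s\<^sup>2 - 3" by linarith
      ultimately show ?thesis using s by simp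
    qed
    have q: "(q \<longlongrightarrow> -1) at_bot" "(q \<longlongrightarrow> 1) at_top" unfolding q_def by real_asymp+
    have "((\<lambda>y. pi * q y + pi * q y ^ 3) \<longlongrightarrow> pi * (-1) + pi * (-1) ^ 3) at_bot"
      "((\<lambda>y. pi * q y + pi * q y ^ 3) \<longlongrightarrow> pi * 1 + pi * 1 ^ 3) at_top"
      by (intro tendsto_intros q)+
    then show "((\<lambda>y. pi * q y + pi * q y ^ 3) \<longlongrightarrow> - (2 * pi)) at_bot"
      "((\<lambda>y. pi * q y + pi * q y ^ 3) \<longlongrightarrow> 2 * pi) at_top" by simp_all
  qed
  finally show ?thesis by simp
qed

text \<open>The integrand is \<open>2 |h'|^2\<close> at the folded point, where
  \<open>|h'| = 2 / d^2\<close> and \<open>d\<close> is the distance to the pole. Horizontal lines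
  contribute \<open>4 pi / (\<bar>y\<bar> + a)^3\<close>, and each half-plane carries half of the
  total.\<close>

lemma nn_integral_energy_density:
  assumes "0 < a"
  shows "(\<integral>\<^sup>+z. ennreal (8 / ((Re z)\<^sup>2 + (\<bar>Im z\<bar> + a)\<^sup>2)\<^sup>2) \<partial>lborel) = ennreal (4 * pi / a\<^sup>2)"
proof -
  let ?f = "\<lambda>y. 4 * pi / (\<bar>y\<bar> + a) ^ 3"
  have half: "(\<integral>\<^sup>+y. ennreal (?f y) * indicator {0..} y \<partial>lborel) = ennreal (2 * pi / a\<^sup>2)"
  proof -
    have "(\<integral>\<^sup>+y. ennreal (?f y) * indicator {0..} y \<partial>lborel)
        = (\<integral>\<^sup>+y. ennreal (4 * pi / (y + a) ^ 3) * indicator {0..} y \<partial>lborel)"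
      by (intro nn_integral_cong) (auto simp: indicator_def)
    also have "\<dots> = ennreal (0 - (- (2 * pi / (0 + a)\<^sup>2)))"
    proof (rule nn_integral_FTC_atLeast)
      show "DERIV (\<lambda>y. - (2 * pi / (y + a)\<^sup>2)) y :> 4 * pi / (y + a) ^ 3" if "0 \<le> y" for y
        using that assms
        by (auto intro!: derivative_eq_intros simp: divide_simps power_numeral_reduce)
      show "((\<lambda>y. - (2 * pi / (y + a)\<^sup>2)) \<longlongrightarrow> 0) at_top" by real_asymp
    qed (use assms in auto)
    finally show ?thesis by simp
  qed
  have "(\<integral>\<^sup>+z. ennreal (8 / ((Re z)\<^sup>2 + (\<bar>Im z\<bar> + a)\<^sup>2)\<^sup>2) \<partial>lborel)
      = (\<integral>\<^sup>+y. \<integral>\<^sup>+x. ennreal (8 / (x\<^sup>2 + (\<bar>y\<bar> + a)\<^sup>2)\<^sup>2) \<partial>lborel \<partial>lborel)"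
    by (subst nn_integral_lborel_Complex) simp_all
  also have "\<dots> = (\<integral>\<^sup>+y. ennreal (?f y) \<partial>lborel)"
    using assms by (subst nn_integral_inverse_quartic) (auto simp: add_nonneg_pos)
  also have "\<dots> = (\<integral>\<^sup>+y. ennreal (?f y) * indicator {0..} y + ennreal (?f y) * indicator {..0} y \<partial>lborel)"
  proof (rule nn_integral_cong_AE)
    have "AE y in lborel. y \<noteq> (0::real)" by (rule AE_lborel_singleton)
    then show "AE y in lborel. ennreal (?f y)
        = ennreal (?f y) * indicator {0..} y + ennreal (?f y) * indicator {..0} y"
      by eventually_elim (auto simp: indicator_def)
  qed
  also have "\<dots> = (\<integral>\<^sup>+y. ennreal (?f y) * indicator {0..} y \<partial>lborel)
      + (\<integral>\<^sup>+y. ennreal (?f y) * indicator {..0} y \<partial>lborel)"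
    by (intro nn_integral_add) auto
  also have "(\<integral>\<^sup>+y. ennreal (?f y) * indicator {..0} y \<partial>lborel)
      = (\<integral>\<^sup>+y. ennreal (?f y) * indicator {0..} y \<partial>lborel)"
    by (subst nn_integral_real_affine[where c = "-1" and t = 0])
      (auto intro!: nn_integral_cong simp: indicator_def)
  finally show ?thesis
    using assms by (simp add: half flip: ennreal_plus)
qed

subsection \<open>The Dirichlet energy\<close>

lemma complex_Basis: "1 \<in> (Basis :: complex set)" "\<i> \<in> (Basis :: complex set)"
  by (auto simp: Basis_complex_def)

lemma is_weak_partial_cong_AE:
  assumes "is_weak_partial b u g" "L2_loc k" "AE z in lborel. g z = k z"
  shows "is_weak_partial b u k"
proof -
  note [measurable] = is_weak_partialD(2)[OF assms(1)] L2_locD(1)[OF assms(2)]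
  have "(LINT z|lborel. \<phi> z *\<^sub>R g z) = (LINT z|lborel. \<phi> z *\<^sub>R k z)" if \<phi>: "test_function \<phi>" for \<phi>
  proof (rule integral_cong_AE)
    note [measurable] = test_function_measurable[OF \<phi>]
    show "(\<lambda>z. \<phi> z *\<^sub>R g z) \<in> borel_measurable lborel" "(\<lambda>z. \<phi> z *\<^sub>R k z) \<in> borel_measurable lborel"
      by simp_all
  qed (use assms(3) in \<open>eventually_elim, simp\<close>)
  with assms show ?thesis by (simp add: is_weak_partial_def)
qed

text \<open>Replaces the representatives chosen in \<open>weak_partial\<close> by given ones: weak
  derivatives agree almost everywhere.\<close>

lemma dirichlet_energy_eq:
  assumes g: "is_weak_partial 1 u g\<^sub>1" "is_weak_partial \<i> u g\<^sub>2"
  shows "dirichlet_energy u = (\<integral>\<^sup>+z. ennreal ((norm (g\<^sub>1 z))\<^sup>2 + (norm (g\<^sub>2 z))\<^sup>2) \<partial>lborel)"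
  unfolding dirichlet_energy_def
proof (rule nn_integral_cong_AE)
  note w = g[THEN is_weak_partial_weak_partial]
  from weak_partial_AE_unique[OF w(1) g(1)] weak_partial_AE_unique[OF w(2) g(2)]
  show "AE z in lborel. ennreal (\<Sum>b\<in>Basis. (norm (weak_partial b u z))\<^sup>2)
      = ennreal ((norm (g\<^sub>1 z))\<^sup>2 + (norm (g\<^sub>2 z))\<^sup>2)"
    by eventually_elim (simp add: Basis_complex_def)
qed

text \<open>Disposes of the real line, which is both the crease of the folding and the common
  boundary of the half-planes.\<close>

lemma AE_Im_neq_0: "AE z in lborel. Im z \<noteq> 0"
proof -
  have "negligible {z. z \<bullet> \<i> = (0::real)}"
    by (rule negligible_standard_hyperplane) (rule complex_Basis)
  then have "{z. z \<bullet> \<i> = 0} \<in> null_sets (completion lborel)"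
    by (simp add: negligible_iff_null_sets)
  moreover have "{z::complex. z \<bullet> \<i> = 0} \<in> sets lborel" by simp
  ultimately have "{z::complex. z \<bullet> \<i> = 0} \<in> null_sets lborel"
    by (simp add: null_sets_completion_iff)
  from AE_not_in[OF this] show ?thesis by simp
qed

subsection \<open>The candidate minimizer\<close>

text \<open>It is the identity on the lower half-plane and complex conjugation on the upper one, so
  both branches of the candidate become the single formula \<open>h (fold_lower z)\<close>.\<close>

definition fold_lower :: "complex \<Rightarrow> complex" where
  "fold_lower z = Complex (Re z) (- \<bar>Im z\<bar>)"

text \<open>Squared distance of \<open>fold_lower z\<close> to the pole \<open>\<i> a\<close>; the function \<open>pole_sq\<close> further below agrees
  with it on the lower half-plane but is smooth on the whole plane.\<close>

definition pole_dist2 :: "real \<Rightarrow> complex \<Rightarrow> real" where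
  "pole_dist2 a z = (Re z)\<^sup>2 + (\<bar>Im z\<bar> + a)\<^sup>2"

definition bubble :: "real \<Rightarrow> complex \<Rightarrow> complex" where
  "bubble a z = 2 / (fold_lower z - \<i> * of_real a)"

text \<open>This is \<open>h'\<close> at the folded point. Folding commutes with horizontal shifts,
  so on both half-planes it is the horizontal derivative of \<open>bubble\<close>.\<close>

definition bubble_deriv :: "real \<Rightarrow> complex \<Rightarrow> complex" where
  "bubble_deriv a z = - 2 / (fold_lower z - \<i> * of_real a)\<^sup>2"

lemma norm_pole: "(norm (fold_lower z - \<i> * of_real a))\<^sup>2 = pole_dist2 a z"
  unfolding cmod_power2
  by (simp add: fold_lower_def pole_dist2_def power2_eq_square algebra_simps)

lemma norm_pole_ge: "a \<le> norm (fold_lower z - \<i> * of_real a)"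
  using abs_Im_le_cmod[of "fold_lower z - \<i> * of_real a"] by (simp add: fold_lower_def)

lemma norm_fold_lower_diff: "norm (fold_lower z - fold_lower w) \<le> norm (z - w)"
proof -
  have "\<bar>\<bar>Im w\<bar> - \<bar>Im z\<bar>\<bar> \<le> \<bar>Im z - Im w\<bar>" by linarith
  then have "(\<bar>Im w\<bar> - \<bar>Im z\<bar>)\<^sup>2 \<le> (Im z - Im w)\<^sup>2" by (simp only: abs_le_square_iff)
  then have "(norm (fold_lower z - fold_lower w))\<^sup>2 \<le> (norm (z - w))\<^sup>2"
    by (simp add: cmod_power2 fold_lower_def)
  then show ?thesis by (rule power2_le_imp_le) simp
qed

lemma norm_bubble_deriv: "norm (bubble_deriv a z) = 2 / pole_dist2 a z"
  by (simp add: bubble_deriv_def norm_divide norm_power norm_pole)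

context
  fixes a :: real
  assumes a: "0 < a"
begin

lemma pole_neq: "fold_lower z - \<i> * of_real a \<noteq> 0"
  using norm_pole_ge[of a z] a by auto

lemma pole_dist2_ge: "a\<^sup>2 \<le> pole_dist2 a z"
  unfolding norm_pole[symmetric] using a by (intro power_mono norm_pole_ge) simp

lemma pole_dist2_pos: "0 < pole_dist2 a z"
  using pole_dist2_ge[of z] zero_less_power[OF a, of 2] by linarith

lemma norm_bubble_le: "norm (bubble a z) \<le> 2 / a"
  unfolding bubble_def norm_divide using a norm_pole_ge[of a z] by (intro frac_le) simp_all

lemma bubble_lipschitz: "norm (bubble a z - bubble a w) \<le> 2 / a\<^sup>2 * norm (z - w)"
proof -
  let ?z = "fold_lower z - \<i> * of_real a" and ?w = "fold_lower w - \<i> * of_real a"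
  have "bubble a z - bubble a w = 2 * (fold_lower w - fold_lower z) / (?z * ?w)"
    unfolding bubble_def using pole_neq[of z] pole_neq[of w] by (simp add: field_simps)
  then have "norm (bubble a z - bubble a w) = 2 * norm (fold_lower w - fold_lower z) / (norm ?z * norm ?w)"
    by (simp only: norm_divide norm_mult norm_numeral)
  also have "\<dots> \<le> 2 * norm (z - w) / (a * a)"
    using a norm_fold_lower_diff[of w z] norm_pole_ge[of a z] norm_pole_ge[of a w]
    by (intro frac_le mult_left_mono mult_mono) (auto simp: norm_minus_commute)
  finally show ?thesis by (simp add: power2_eq_square)
qed

lemma holomorphic_derivative_pole:
  "w \<noteq> \<i> * of_real a \<Longrightarrow> ((\<lambda>w. 2 / (w - \<i> * of_real a)) has_field_derivative - 2 / (w - \<i> * of_real a)\<^sup>2) (at w)"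
  by (auto intro!: derivative_eq_intros simp: power2_eq_square)

text \<open>The chain rule for \<open>h\<close> after the folding: \<open>c\<close> is the direction
  into which the folding turns \<open>b\<close>, and the hypothesis says that the folding is affine
  along \<open>b\<close> close to \<open>z\<close>.\<close>

lemma bubble_derivative_along:
  assumes "eventually (\<lambda>t. fold_lower (z + t *\<^sub>R b) = fold_lower z + t *\<^sub>R c) (nhds 0)"
  shows "((\<lambda>t. bubble a (z + t *\<^sub>R b)) has_vector_derivative bubble_deriv a z * c) (at 0)"
proof -
  have "((\<lambda>t. fold_lower z + t *\<^sub>R c) has_vector_derivative c) (at 0)"
    by (auto intro!: derivative_eq_intros)
  from field_vector_diff_chain_at[OF this, of "\<lambda>w. 2 / (w - \<i> * of_real a)" "bubble_deriv a z"]
  have "((\<lambda>t. 2 / (fold_lower z + t *\<^sub>R c - \<i> * of_real a)) has_vector_derivative c * bubble_deriv a z) (at 0)"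
    using holomorphic_derivative_pole[of "fold_lower z"] pole_neq[of z]
    by (simp add: bubble_deriv_def o_def)
  then have "((\<lambda>t. 2 / (fold_lower z + t *\<^sub>R c - \<i> * of_real a)) has_vector_derivative bubble_deriv a z * c) (at 0)"
    by (simp only: mult.commute)
  then show ?thesis
    unfolding has_vector_derivative_def
    by (rule has_derivative_transform_eventually)
      (use eventually_nhds_x_imp_x[OF assms] assms in \<open>auto simp: bubble_def eventually_at_filter elim!: eventually_mono\<close>)
qed

lemma borel_measurable_fold_lower [measurable]: "fold_lower \<in> borel_measurable borel"
  unfolding fold_lower_def [abs_def]
  by (intro borel_measurable_continuous_onI continuous_intros)

lemma bubble_measurable [measurable]: "bubble a \<in> borel_measurable borel"
  "bubble_deriv a \<in> borel_measurable borel"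
  unfolding bubble_def [abs_def] bubble_deriv_def [abs_def] by measurable

lemma bubble_L2_loc: "L2_loc (bubble a)"
  by (rule L2_loc_bounded[OF _ norm_bubble_le]) simp

lemma norm_bubble_deriv_le: "norm (bubble_deriv a z) \<le> 2 / a\<^sup>2"
  unfolding norm_bubble_deriv
  using a pole_dist2_ge[of z] pole_dist2_pos[of z] by (intro divide_left_mono mult_pos_pos) auto

lemma bubble_weak_partial_1: "is_weak_partial 1 (bubble a) (bubble_deriv a)"
proof (rule lipschitz_is_weak_partial[OF bubble_lipschitz norm_bubble_le _ norm_bubble_deriv_le _ complex_Basis(1)])
  show "AE z in lborel. ((\<lambda>t. bubble a (z + t *\<^sub>R 1)) has_vector_derivative bubble_deriv a z) (at 0)"
    using bubble_derivative_along[of _ 1 1]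
    by (intro always_eventually allI) (simp add: fold_lower_def complex_eq_iff)
qed simp

text \<open>The vertical derivative: folding turns \<open>\<i>\<close> into \<open>\<i>\<close>
  below the real line and into \<open>- \<i>\<close> above it. The value on the line itself is
  immaterial, as the line is a null set.\<close>

definition bubble_deriv_i :: "complex \<Rightarrow> complex" where
  "bubble_deriv_i z = (if Im z < 0 then \<i> else - \<i>) * bubble_deriv a z"

lemma norm_bubble_deriv_i: "norm (bubble_deriv_i z) = norm (bubble_deriv a z)"
  by (simp add: bubble_deriv_i_def norm_mult)

lemma bubble_deriv_i_measurable [measurable]: "bubble_deriv_i \<in> borel_measurable borel"
  unfolding bubble_deriv_i_def [abs_def] by measurable

lemma bubble_weak_partial_i: "is_weak_partial \<i> (bubble a) bubble_deriv_i"
proof (rule lipschitz_is_weak_partial[OF bubble_lipschitz norm_bubble_le _ _ _ complex_Basis(2)])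
  show "norm (bubble_deriv_i z) \<le> 2 / a\<^sup>2" for z
    unfolding norm_bubble_deriv_i by (rule norm_bubble_deriv_le)
  show "AE z in lborel. ((\<lambda>t. bubble a (z + t *\<^sub>R \<i>)) has_vector_derivative bubble_deriv_i z) (at 0)"
    using AE_Im_neq_0
  proof eventually_elim
    fix z assume z: "Im z \<noteq> 0"
    define c where "c = (if Im z < 0 then \<i> else - \<i>)"
    have "eventually (\<lambda>t. t \<in> {- \<bar>Im z\<bar><..<\<bar>Im z\<bar>}) (nhds 0)"
      using z by (intro eventually_nhds_in_open) auto
    then have "eventually (\<lambda>t. fold_lower (z + t *\<^sub>R \<i>) = fold_lower z + t *\<^sub>R c) (nhds 0)"
      by eventually_elim (use z in \<open>auto simp: fold_lower_def c_def complex_eq_iff abs_if split: if_splits\<close>)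
    from bubble_derivative_along[OF this]
    show "((\<lambda>t. bubble a (z + t *\<^sub>R \<i>)) has_vector_derivative bubble_deriv_i z) (at 0)"
      by (simp add: bubble_deriv_i_def c_def mult.commute)
  qed
qed simp

lemma pole_dist2_measurable [measurable]: "pole_dist2 a \<in> borel_measurable borel"
  unfolding pole_dist2_def [abs_def] by (intro borel_measurable_continuous_onI continuous_intros)

lemma nn_integral_pole_dist2: "(\<integral>\<^sup>+z. ennreal (8 / (pole_dist2 a z)\<^sup>2) \<partial>lborel) = ennreal (4 * pi / a\<^sup>2)"
  using nn_integral_energy_density[OF a] by (simp add: pole_dist2_def)

lemma integrable_pole_dist2: "integrable lborel (\<lambda>z. 8 / (pole_dist2 a z)\<^sup>2)"
  by (rule integrableI_nn_integral_finite[where x = "4 * pi / a\<^sup>2"]) (simp_all add: nn_integral_pole_dist2)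

lemma bubble_energy_density: "(norm (bubble_deriv a z))\<^sup>2 + (norm (bubble_deriv_i z))\<^sup>2 = 8 / (pole_dist2 a z)\<^sup>2"
  by (simp add: norm_bubble_deriv_i norm_bubble_deriv power_divide)

lemma bubble_energy: "dirichlet_energy (bubble a) = ennreal (4 * pi / a\<^sup>2)"
  by (simp add: dirichlet_energy_eq[OF bubble_weak_partial_1 bubble_weak_partial_i]
      bubble_energy_density nn_integral_pole_dist2)

end

subsection \<open>Orthogonality\<close>

lemma Ck_partial_measurable:
  assumes "\<And>k. Ck k H" "b \<in> Basis"
  shows "partial b H \<in> borel_measurable borel"
  using Ck_SucD(2)[OF assms, of 0] by (simp add: borel_measurable_continuous_onI)

text \<open>The derivative is continuous on \<open>{0..1}\<close> and vanishes outside it, where the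
  step is constant. The bound is what makes estimates for rescaled steps uniform in the
  scale.\<close>

lemma smooth_step_derivative_bounded:
  obtains D S where "\<And>t. (smooth_step has_real_derivative D t) (at t)" "\<And>t. \<bar>D t\<bar> \<le> S"
    "0 < S" "\<And>t. t < 0 \<Longrightarrow> D t = 0"
proof -
  let ?e = "flat_exp 1" and ?e' = "flat_exp ([:0, 0, 1:] * (1 - pderiv 1))"
  let ?n = "\<lambda>t. ?e t + ?e (1 - t)" and ?n' = "\<lambda>t. ?e' t - ?e' (1 - t)"
  define D where "D t = (?e' t * ?n t - ?e t * ?n' t) / (?n t * ?n t)" for t
  have n: "?n t \<noteq> 0" for t using smooth_step_denom_pos[of t] by simp
  have "DERIV (\<lambda>t. ?e (1 - t)) t :> ?e' (1 - t) * (- 1)" for t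
    by (rule DERIV_chain2[OF flat_exp_DERIV]) (auto intro!: derivative_eq_intros)
  from DERIV_add[OF flat_exp_DERIV[of 1] this] have "DERIV ?n t :> ?n' t" for t by simp
  from DERIV_divide[OF flat_exp_DERIV[of 1] this n]
  have D: "DERIV smooth_step t :> D t" for t
    by (simp add: D_def smooth_step_def [abs_def] divide_inverse[symmetric])
  have "continuous_on UNIV (flat_exp p)" for p
    using DERIV_isCont[OF flat_exp_DERIV] by (simp add: continuous_at_imp_continuous_on)
  then have e: "continuous_on {0..1} (\<lambda>t. flat_exp p (f t))" if "continuous_on {0..1} f" for p and f :: "real \<Rightarrow> real"
    using that by (rule continuous_on_compose2) auto
  have "continuous_on {0..1} D"
    unfolding D_def using n by (intro continuous_intros e) auto
  then have "bounded (D ` {0..1})"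
    by (intro compact_imp_bounded compact_continuous_image) auto
  then obtain S where S: "0 < S" "\<And>t. t \<in> {0..1} \<Longrightarrow> \<bar>D t\<bar> \<le> S"
    by (auto simp: bounded_pos)
  have const: "D t = 0" if "open U" "t \<in> U" "\<And>s. s \<in> U \<Longrightarrow> smooth_step s = c" for t c U
  proof (rule DERIV_unique[OF D])
    show "DERIV smooth_step t :> 0"
      by (rule has_field_derivative_transform_within_open[OF DERIV_const that(1,2)]) (simp add: that(3))
  qed
  have D0: "D t = 0" if "t < 0" for t
    by (rule const[of "{..<0}" _ 0]) (use that in \<open>auto simp: smooth_step_eq_0\<close>)
  have D1: "D t = 0" if "1 < t" for t
    by (rule const[of "{1<..}" _ 1]) (use that in \<open>auto simp: smooth_step_eq_1\<close>)
  have "\<bar>D t\<bar> \<le> S" for t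
    using S D0[of t] D1[of t] by (cases "t < 0"; cases "1 < t") auto
  then show thesis by (rule that[OF D _ S(1) D0])
qed

section \<open>Cutoffs centred at the pole\<close>

context
  fixes a :: real
  assumes a: "0 < a"
begin

definition pole_sq :: "complex \<Rightarrow> real" where
  "pole_sq z = Re z * Re z + (Im z - a) * (Im z - a)"

lemma pole_sq_eq: "Im z < 0 \<Longrightarrow> pole_sq z = pole_dist2 a z"
  by (simp add: pole_sq_def pole_dist2_def power2_eq_square algebra_simps)

lemma Ck_pole_sq: "Ck k pole_sq"
  unfolding pole_sq_def [abs_def] by (intro Ck_add Ck_mult Ck_diff Ck_const Ck_Re Ck_Im)

lemma partial_pole_sq: "\<bar>partial 1 pole_sq z\<bar> \<le> 2 * sqrt (pole_sq z)" "\<bar>partial \<i> pole_sq z\<bar> \<le> 2 * sqrt (pole_sq z)"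
proof -
  have d: "(pole_sq has_derivative (\<lambda>h. 2 * (Re z * Re h + (Im z - a) * Im h))) (at z)"
    unfolding pole_sq_def [abs_def]
    by (auto intro!: derivative_eq_intros simp: fun_eq_iff algebra_simps)
  have "partial 1 pole_sq z = 2 * Re z" "partial \<i> pole_sq z = 2 * (Im z - a)"
    using partial_has_derivative[OF d] by simp_all
  moreover have "\<bar>Re z\<bar> \<le> sqrt (pole_sq z)" "\<bar>Im z - a\<bar> \<le> sqrt (pole_sq z)"
    by (auto intro!: real_le_rsqrt simp: pole_sq_def power2_eq_square)
  ultimately show "\<bar>partial 1 pole_sq z\<bar> \<le> 2 * sqrt (pole_sq z)" "\<bar>partial \<i> pole_sq z\<bar> \<le> 2 * sqrt (pole_sq z)"
    by auto
qed

text \<open>It equals 1 where \<open>pole_sq z \<le> Suc n\<close> and 0 where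
  \<open>pole_sq z \<ge> 2 * Suc n\<close>. Using the squared distance keeps it smooth at the
  pole.\<close>

definition cutoff :: "nat \<Rightarrow> complex \<Rightarrow> real" where
  "cutoff n z = smooth_step (2 - inverse (real (Suc n)) * pole_sq z)"

lemma Ck_cutoff: "Ck k (cutoff n)"
  unfolding cutoff_def [abs_def] by (intro Ck_smooth_step Ck_diff Ck_mult Ck_const Ck_pole_sq)

lemma test_function_cutoff: "test_function (cutoff n)"
proof (rule test_functionI[OF Ck_cutoff])
  let ?N = "real (Suc n)"
  fix z :: complex assume z: "a + 2 * ?N < norm z"
  have "norm z \<le> norm (z - \<i> * of_real a) + a"
    using norm_triangle_ineq[of "z - \<i> * of_real a" "\<i> * of_real a"] a by (simp add: norm_mult)
  with z have *: "2 * ?N < norm (z - \<i> * of_real a)" by linarith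
  have "(norm (z - \<i> * of_real a))\<^sup>2 = pole_sq z"
    unfolding cmod_power2 by (simp add: pole_sq_def power2_eq_square)
  moreover have "(2 * ?N)\<^sup>2 \<le> (norm (z - \<i> * of_real a))\<^sup>2" using * by (intro power_mono) auto
  moreover have "2 * ?N \<le> (2 * ?N)\<^sup>2" by (rule self_le_power) auto
  ultimately have "2 * ?N \<le> pole_sq z" by linarith
  then have "2 \<le> inverse ?N * pole_sq z" by (simp add: field_simps del: of_nat_Suc)
  then show "cutoff n z = 0" by (simp add: cutoff_def smooth_step_eq_0 del: of_nat_Suc)
qed

text \<open>The first bound tends to 0 at every fixed point, the second is uniform in
  \<open>n\<close> and serves as a majorant. The chain rule gives the first; it implies the second
  because the derivative vanishes unless \<open>pole_sq z \<le> 2 * Suc n\<close>, where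
  \<open>1 / Suc n \<le> 2 / pole_sq z\<close>.\<close>

lemma cutoff_bounds:
  obtains S where "0 < S" "\<And>n b z. b \<in> {1, \<i>} \<Longrightarrow> \<bar>partial b (cutoff n) z\<bar> \<le> S * sqrt (pole_sq z) / Suc n"
    "\<And>n b z. b \<in> {1, \<i>} \<Longrightarrow> 0 < pole_sq z \<Longrightarrow> \<bar>partial b (cutoff n) z\<bar> \<le> S / sqrt (pole_sq z)"
proof -
  obtain D S where D: "\<And>t. (smooth_step has_real_derivative D t) (at t)" "\<And>t. \<bar>D t\<bar> \<le> S"
    "0 < S" "\<And>t. t < 0 \<Longrightarrow> D t = 0"
    using smooth_step_derivative_bounded by blast
  have p: "partial b (cutoff n) z = D (2 - inverse (real (Suc n)) * pole_sq z) * (- inverse (real (Suc n)) * partial b pole_sq z)" for b n z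
  proof (rule partial_has_derivative)
    have "(pole_sq has_derivative (\<lambda>b. partial b pole_sq z)) (at z)"
      by (rule has_derivative_frechet_partial, rule Ck_SucD(1)[OF Ck_pole_sq])
    then have "((\<lambda>z. 2 - inverse (real (Suc n)) * pole_sq z) has_derivative
        (\<lambda>b. - inverse (real (Suc n)) * partial b pole_sq z)) (at z)"
      by (auto intro!: derivative_eq_intros)
    from has_derivative_compose[OF this D(1)[unfolded has_field_derivative_def]]
    show "(cutoff n has_derivative (\<lambda>b. D (2 - inverse (real (Suc n)) * pole_sq z)
        * (- inverse (real (Suc n)) * partial b pole_sq z))) (at z)"
      unfolding cutoff_def [abs_def] .
  qed
  have le: "\<bar>partial b (cutoff n) z\<bar> \<le> 2 * S * sqrt (pole_sq z) / Suc n" if "b \<in> {1, \<i>}" for b n z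
  proof -
    have "\<bar>partial b (cutoff n) z\<bar> = \<bar>D (2 - inverse (real (Suc n)) * pole_sq z)\<bar> * (\<bar>partial b pole_sq z\<bar> / Suc n)"
      unfolding p by (simp add: abs_mult divide_inverse mult_ac)
    also have "\<dots> \<le> S * (2 * sqrt (pole_sq z) / Suc n)"
      using that partial_pole_sq[of z] D(2,3) by (intro mult_mono divide_right_mono) auto
    finally show ?thesis by (simp add: mult_ac)
  qed
  show thesis
  proof (rule that[of "4 * S"])
    show "0 < 4 * S" using D(3) by simp
    fix b n z assume b: "b \<in> {1, \<i>}"
    have "2 * S * sqrt (pole_sq z) / Suc n \<le> 4 * S * sqrt (pole_sq z) / Suc n"
      using D(3) by (intro divide_right_mono mult_right_mono) (auto simp: pole_sq_def)
    with le[OF b, of n z] show "\<bar>partial b (cutoff n) z\<bar> \<le> 4 * S * sqrt (pole_sq z) / Suc n" by linarith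
    assume q: "0 < pole_sq z"
    show "\<bar>partial b (cutoff n) z\<bar> \<le> 4 * S / sqrt (pole_sq z)"
    proof (cases "pole_sq z \<le> 2 * real (Suc n)")
      case True
      have "2 * S * sqrt (pole_sq z) / Suc n \<le> 4 * S / sqrt (pole_sq z)"
        using True q D(3) by (simp add: divide_simps mult_ac)
      with le[OF b, of n z] show ?thesis by linarith
    next
      case False
      then have "2 - inverse (real (Suc n)) * pole_sq z < 0"
        by (simp add: field_simps del: of_nat_Suc)
      then show ?thesis using D(3) q by (simp add: p D(4))
    qed
  qed
qed

text \<open>The curl identity holds for the test functions \<open>cutoff n * H\<close> and passes to
  the limit. With \<open>d\<close> the distance to the pole, a derivative of the cutoff costs a
  factor of order \<open>1 / d\<close> and \<open>H\<close> is itself of order \<open>1 / d\<close>,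
  so all derivatives of the products are bounded by a multiple of \<open>1 / d^2\<close>, which is
  square integrable over the lower half-plane. Elsewhere \<open>k\<^sub>1\<close> and
  \<open>k\<^sub>2\<close> vanish, hence \<open>H\<close> is controlled only below the real
  line.\<close>

lemma integral_curl_cutoff:
  assumes H: "\<And>k. Ck k H"
    and bounds: "\<And>z. Im z < 0 \<Longrightarrow> \<bar>H z\<bar> \<le> C / sqrt (pole_dist2 a z)"
      "\<And>b z. b \<in> {1, \<i>} \<Longrightarrow> Im z < 0 \<Longrightarrow> \<bar>partial b H z\<bar> \<le> C / pole_dist2 a z"
    and k: "is_weak_partial 1 w k\<^sub>1" "is_weak_partial \<i> w k\<^sub>2"
    and L2: "integrable lborel (\<lambda>z. (norm (k\<^sub>1 z))\<^sup>2)" "integrable lborel (\<lambda>z. (norm (k\<^sub>2 z))\<^sup>2)"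
    and zero: "AE z in lborel. 0 \<le> Im z \<longrightarrow> k\<^sub>1 z = 0" "AE z in lborel. 0 \<le> Im z \<longrightarrow> k\<^sub>2 z = 0"
  shows "integrable lborel (\<lambda>z. partial \<i> H z *\<^sub>R k\<^sub>1 z)" "integrable lborel (\<lambda>z. partial 1 H z *\<^sub>R k\<^sub>2 z)"
    "(LINT z|lborel. partial \<i> H z *\<^sub>R k\<^sub>1 z) = (LINT z|lborel. partial 1 H z *\<^sub>R k\<^sub>2 z)"
proof -
  obtain S where S: "0 < S" "\<And>n b z. b \<in> {1, \<i>} \<Longrightarrow> \<bar>partial b (cutoff n) z\<bar> \<le> S * sqrt (pole_sq z) / Suc n"
    "\<And>n b z. b \<in> {1, \<i>} \<Longrightarrow> 0 < pole_sq z \<Longrightarrow> \<bar>partial b (cutoff n) z\<bar> \<le> S / sqrt (pole_sq z)"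
    using cutoff_bounds by blast
  have C: "0 \<le> C"
    using order_trans[OF abs_ge_zero bounds(1)[of "- \<i>"]] pole_dist2_pos[OF a, of "- \<i>"]
    by (simp add: zero_le_divide_iff not_le[symmetric])
  define \<psi> where "\<psi> n = (\<lambda>z. cutoff n z * H z)" for n
  have \<psi>: "test_function (\<psi> n)" for n
    unfolding \<psi>_def by (rule test_function_mult[OF test_function_cutoff H])
  have p\<psi>: "partial b (\<psi> n) z = cutoff n z * partial b H z + partial b (cutoff n) z * H z" for b n z
    unfolding \<psi>_def by (intro partial_mult Ck_SucD(1)[OF Ck_cutoff] Ck_SucD(1)[OF H])
  have c01: "0 \<le> cutoff n z" "cutoff n z \<le> 1" for n z
    by (simp_all add: cutoff_def smooth_step_nonneg smooth_step_le_1)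
  have bound: "\<bar>partial b (\<psi> n) z\<bar> \<le> (C + S * C) / pole_dist2 a z" if b: "b \<in> {1, \<i>}" and z: "Im z < 0" for b n z
  proof -
    note q = pole_dist2_pos[OF a, of z]
    have "\<bar>partial b (\<psi> n) z\<bar> \<le> \<bar>cutoff n z\<bar> * \<bar>partial b H z\<bar> + \<bar>partial b (cutoff n) z\<bar> * \<bar>H z\<bar>"
      unfolding p\<psi> by (metis abs_mult abs_triangle_ineq)
    also have "\<dots> \<le> 1 * (C / pole_dist2 a z) + S / sqrt (pole_dist2 a z) * (C / sqrt (pole_dist2 a z))"
      using S(1) S(3)[OF b, of z] bounds(1)[OF z] bounds(2)[OF b z] q c01[of n z]
      by (intro add_mono mult_mono) (auto simp: pole_sq_eq[OF z])
    also have "\<dots> = (C + S * C) / pole_dist2 a z"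
      using q by (simp add: add_divide_distrib)
    finally show ?thesis .
  qed
  have lim: "(\<lambda>n. partial b (\<psi> n) z) \<longlonglongrightarrow> partial b H z" if b: "b \<in> {1, \<i>}" for b z
  proof -
    have inv: "(\<lambda>n. inverse (real (Suc n))) \<longlonglongrightarrow> 0" by (rule LIMSEQ_inverse_real_of_nat)
    have "(\<lambda>n. 2 - inverse (real (Suc n)) * pole_sq z) \<longlonglongrightarrow> 2 - 0 * pole_sq z"
      by (intro tendsto_intros inv)
    then have "eventually (\<lambda>n. 1 < 2 - inverse (real (Suc n)) * pole_sq z) sequentially"
      by (rule order_tendstoD) simp
    then have "eventually (\<lambda>n. cutoff n z = 1) sequentially"
      by eventually_elim (simp add: cutoff_def smooth_step_eq_1)
    then have "(\<lambda>n. cutoff n z) \<longlonglongrightarrow> 1" by (rule tendsto_eventually)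
    moreover have "(\<lambda>n. partial b (cutoff n) z) \<longlonglongrightarrow> 0"
    proof (rule Lim_null_comparison)
      show "eventually (\<lambda>n. norm (partial b (cutoff n) z) \<le> S * sqrt (pole_sq z) * inverse (real (Suc n))) sequentially"
        using S(2)[OF b] by (intro always_eventually allI) (simp add: divide_inverse)
      show "(\<lambda>n. S * sqrt (pole_sq z) * inverse (real (Suc n))) \<longlonglongrightarrow> 0"
        using tendsto_mult_right_zero[OF inv] .
    qed
    ultimately have "(\<lambda>n. partial b (\<psi> n) z) \<longlonglongrightarrow> 1 * partial b H z + 0 * H z"
      unfolding p\<psi> by (intro tendsto_intros)
    then show ?thesis by simp
  qed
  have main: "integrable lborel (\<lambda>z. partial b H z *\<^sub>R k z) \<and>
      (\<lambda>n. LINT z|lborel. partial b (\<psi> n) z *\<^sub>R k z) \<longlonglongrightarrow> (LINT z|lborel. partial b H z *\<^sub>R k z)"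
    if b: "b \<in> {1, \<i>}" and [measurable]: "k \<in> borel_measurable borel"
      and kL: "integrable lborel (\<lambda>z. (norm (k z))\<^sup>2)" and k0: "AE z in lborel. 0 \<le> Im z \<longrightarrow> k z = 0" for b and k :: "complex \<Rightarrow> complex"
  proof -
    from b have b': "b \<in> Basis" by (auto simp: Basis_complex_def)
    define M where "M = C + S * C"
    have M: "0 \<le> M" using C S(1) by (simp add: M_def)
    have [measurable]: "partial b H \<in> borel_measurable borel"
      by (rule Ck_partial_measurable[OF H b'])
    \<comment> \<open>The inequality \<open>x * y \<le> x^2 + y^2\<close> plays the part of
      Cauchy-Schwarz; the square of \<open>M / pole_dist2 a z\<close> is a multiple of the energy
      density of the candidate.\<close>
    have dom: "integrable lborel (\<lambda>z. M / pole_dist2 a z * norm (k z))"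
    proof (rule Bochner_Integration.integrable_bound)
      show "integrable lborel (\<lambda>z. M\<^sup>2 / 8 * (8 / (pole_dist2 a z)\<^sup>2) + (norm (k z))\<^sup>2)"
        by (intro Bochner_Integration.integrable_add integrable_mult_right integrable_pole_dist2[OF a] kL)
      have "norm (M / pole_dist2 a z * norm (k z)) \<le> norm (M\<^sup>2 / 8 * (8 / (pole_dist2 a z)\<^sup>2) + (norm (k z))\<^sup>2)" for z
      proof -
        let ?x = "M / pole_dist2 a z"
        have x: "0 \<le> ?x" using M pole_dist2_pos[OF a, of z] by simp
        have "?x * norm (k z) \<le> ?x\<^sup>2 + (norm (k z))\<^sup>2"
          using sum_squares_bound[of ?x "norm (k z)"] mult_nonneg_nonneg[OF x norm_ge_zero[of "k z"]] by linarith
        moreover have "norm (?x * norm (k z)) = ?x * norm (k z)"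
          using mult_nonneg_nonneg[OF x norm_ge_zero[of "k z"]] by (simp only: real_norm_def abs_of_nonneg)
        ultimately show ?thesis by (simp add: power_divide)
      qed
      then show "AE z in lborel. norm (M / pole_dist2 a z * norm (k z))
          \<le> norm (M\<^sup>2 / 8 * (8 / (pole_dist2 a z)\<^sup>2) + (norm (k z))\<^sup>2)" by simp
    qed (use pole_dist2_measurable[OF a] in measurable)
    have conv: "AE z in lborel. (\<lambda>n. partial b (\<psi> n) z *\<^sub>R k z) \<longlonglongrightarrow> partial b H z *\<^sub>R k z"
      by (intro always_eventually allI tendsto_scaleR lim b tendsto_const)
    have le: "AE z in lborel. norm (partial b (\<psi> n) z *\<^sub>R k z) \<le> M / pole_dist2 a z * norm (k z)" for n
      using k0
    proof eventually_elim
      fix z assume "0 \<le> Im z \<longrightarrow> k z = 0"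
      then show "norm (partial b (\<psi> n) z *\<^sub>R k z) \<le> M / pole_dist2 a z * norm (k z)"
        using mult_right_mono[OF bound[OF b, of z n] norm_ge_zero[of "k z"]]
        by (cases "Im z < 0") (auto simp: M_def)
    qed
    have m: "(\<lambda>z. partial b (\<psi> n) z *\<^sub>R k z) \<in> borel_measurable lborel" for n
      using test_function_measurable[OF test_function_partial[OF \<psi> b']] by measurable
    show ?thesis
      using integrable_dominated_convergence[OF _ m dom conv le] integral_dominated_convergence[OF _ m dom conv le]
      by simp
  qed
  note m1 = main[of \<i>, OF _ is_weak_partialD(2)[OF k(1)] L2(1) zero(1), simplified]
  note m2 = main[of 1, OF _ is_weak_partialD(2)[OF k(2)] L2(2) zero(2), simplified]
  show "integrable lborel (\<lambda>z. partial \<i> H z *\<^sub>R k\<^sub>1 z)" "integrable lborel (\<lambda>z. partial 1 H z *\<^sub>R k\<^sub>2 z)"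
    using m1 m2 by blast+
  have "(LINT z|lborel. partial \<i> (\<psi> n) z *\<^sub>R k\<^sub>1 z) = (LINT z|lborel. partial 1 (\<psi> n) z *\<^sub>R k\<^sub>2 z)" for n
    by (rule integral_curl_eq_0[OF \<psi> k])
  with m1 have "(\<lambda>n. LINT z|lborel. partial 1 (\<psi> n) z *\<^sub>R k\<^sub>2 z) \<longlonglongrightarrow> (LINT z|lborel. partial \<i> H z *\<^sub>R k\<^sub>1 z)"
    by simp
  from LIMSEQ_unique[OF this] m2
  show "(LINT z|lborel. partial \<i> H z *\<^sub>R k\<^sub>1 z) = (LINT z|lborel. partial 1 H z *\<^sub>R k\<^sub>2 z)"
    by blast
qed

section \<open>Stream functions, extended smoothly across the pole\<close>

text \<open>A globally smooth function that agrees with \<open>1 / pole_sq\<close> away from the pole: it is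
  \<open>smooth_step t / t\<close> in the variable \<open>t = pole_sq z / a\<^sup>2\<close>, which is at least \<open>1\<close> where \<open>Im z < 0\<close>.\<close>

definition inv_pole_sq :: "complex \<Rightarrow> real" where
  "inv_pole_sq z = inverse (a\<^sup>2) * (flat_exp [:0, 1:] (inverse (a\<^sup>2) * pole_sq z)
     * inverse (flat_exp 1 (inverse (a\<^sup>2) * pole_sq z) + flat_exp 1 (1 - inverse (a\<^sup>2) * pole_sq z)))"

lemma Ck_inv_pole_sq: "Ck k inv_pole_sq"
proof -
  have "flat_exp 1 t + flat_exp 1 (1 - t) \<noteq> 0" for t
    using smooth_step_denom_pos[of t] by simp
  then show ?thesis
    unfolding inv_pole_sq_def [abs_def]
    by (intro Ck_mult Ck_inverse Ck_add Ck_flat_exp Ck_diff Ck_const Ck_pole_sq)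
qed

text \<open>For \<open>t \<ge> 1\<close> the summand \<open>flat_exp 1 (1 - t)\<close> is 0 and the
  remaining quotient of flat functions is the polynomial factor \<open>1 / t\<close>; on the lower
  half-plane the scaling by \<open>a^2\<close> ensures \<open>t \<ge> 1\<close>.\<close>

lemma inv_pole_sq_eq:
  assumes "Im z < 0"
  shows "inv_pole_sq z = 1 / pole_sq z"
proof -
  have "a\<^sup>2 \<le> pole_sq z" using pole_dist2_ge[OF a, of z] by (simp add: pole_sq_eq[OF assms])
  then have t: "1 \<le> inverse (a\<^sup>2) * pole_sq z" using a by (simp add: field_simps)
  then have "flat_exp [:0, 1:] (inverse (a\<^sup>2) * pole_sq z)
      = inverse (inverse (a\<^sup>2) * pole_sq z) * flat_exp 1 (inverse (a\<^sup>2) * pole_sq z)"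
    by (simp add: flat_exp_def divide_inverse)
  moreover have "flat_exp 1 (inverse (a\<^sup>2) * pole_sq z) \<noteq> 0"
    using flat_exp_1_pos[of "inverse (a\<^sup>2) * pole_sq z"] t by simp
  ultimately show ?thesis
    using t a by (simp add: inv_pole_sq_def flat_exp_nonpos divide_inverse)
qed

text \<open>Meant for \<open>G\<close> the real or the imaginary part. The lower half-plane is open,
  so the derivative of \<open>H\<close> there depends only on the values there, and complex
  differentiability turns the direction \<open>b\<close> into a factor.\<close>

lemma partial_eq_on_lower:
  assumes G: "bounded_linear G" and eq: "\<And>z. Im z < 0 \<Longrightarrow> H z = G (2 / (z - \<i> * of_real a))" and z: "Im z < 0"
  shows "partial b H z = G (bubble_deriv a z * b)"
proof (rule partial_has_derivative)
  have f: "fold_lower z = z" using z by (simp add: fold_lower_def complex_eq_iff)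
  have "((\<lambda>w. 2 / (w - \<i> * of_real a)) has_field_derivative bubble_deriv a z) (at z)"
    using holomorphic_derivative_pole[OF a, of z] pole_neq[OF a, of z] by (simp add: f bubble_deriv_def)
  then have "((\<lambda>w. G (2 / (w - \<i> * of_real a))) has_derivative (\<lambda>h. G (bubble_deriv a z * h))) (at z)"
    unfolding has_field_derivative_def by (rule bounded_linear.has_derivative[OF G])
  moreover have "open {z. Im z < 0}" by (intro open_Collect_less continuous_intros)
  ultimately show "(H has_derivative (\<lambda>h. G (bubble_deriv a z * h))) (at z)"
    by (rule has_derivative_transform_within_open) (use z eq in auto)
qed

text \<open>The two functions come from \<open>h z = 2 * cnj (z - \<i> a) / pole_sq z\<close> by
  taking real and imaginary parts and replacing \<open>1 / pole_sq\<close> by its smooth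
  substitute.\<close>

definition bubble_Re :: "complex \<Rightarrow> real" where "bubble_Re z = 2 * (Re z * inv_pole_sq z)"
definition bubble_Im :: "complex \<Rightarrow> real" where "bubble_Im z = (- 2) * ((Im z - a) * inv_pole_sq z)"

lemma Ck_bubble_Re: "Ck k bubble_Re" and Ck_bubble_Im: "Ck k bubble_Im"
  unfolding bubble_Re_def [abs_def] bubble_Im_def [abs_def]
  by (intro Ck_mult Ck_diff Ck_const Ck_Re Ck_Im Ck_inv_pole_sq)+

lemma bubble_Re_Im_eq:
  assumes "Im z < 0"
  shows "bubble_Re z = Re (2 / (z - \<i> * of_real a))" "bubble_Im z = Im (2 / (z - \<i> * of_real a))"
  unfolding bubble_Re_def bubble_Im_def inv_pole_sq_eq[OF assms]
  by (simp_all add: Re_divide Im_divide pole_sq_def power2_eq_square)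

lemma norm_bubble_lower: "Im z < 0 \<Longrightarrow> norm (2 / (z - \<i> * of_real a)) = 2 / sqrt (pole_dist2 a z)"
proof -
  assume "Im z < 0"
  then have f: "fold_lower z = z" by (simp add: fold_lower_def complex_eq_iff)
  have "sqrt (pole_dist2 a z) = norm (z - \<i> * of_real a)"
    unfolding norm_pole[symmetric] f by simp
  then show ?thesis by (simp add: norm_divide)
qed

lemma bubble_orthogonal:
  assumes k: "is_weak_partial 1 w k\<^sub>1" "is_weak_partial \<i> w k\<^sub>2"
    and L2: "integrable lborel (\<lambda>z. (norm (k\<^sub>1 z))\<^sup>2)" "integrable lborel (\<lambda>z. (norm (k\<^sub>2 z))\<^sup>2)"
    and zero: "AE z in lborel. 0 \<le> Im z \<longrightarrow> k\<^sub>1 z = 0" "AE z in lborel. 0 \<le> Im z \<longrightarrow> k\<^sub>2 z = 0"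
  shows "(LINT z|lborel. bubble_deriv a z \<bullet> k\<^sub>1 z + bubble_deriv_i a z \<bullet> k\<^sub>2 z) = 0"
proof -
  have pRe: "partial b bubble_Re z = Re (bubble_deriv a z * b)" if "Im z < 0" for b z
    by (rule partial_eq_on_lower[OF bounded_linear_Re bubble_Re_Im_eq(1) that])
  have pIm: "partial b bubble_Im z = Im (bubble_deriv a z * b)" if "Im z < 0" for b z
    by (rule partial_eq_on_lower[OF bounded_linear_Im bubble_Re_Im_eq(2) that])
  have nb: "norm (bubble_deriv a z * b) = 2 / pole_dist2 a z" if "b \<in> {1, \<i>}" for b z
    using that by (auto simp: norm_mult norm_bubble_deriv)
  have r: "\<bar>bubble_Re z\<bar> \<le> 2 / sqrt (pole_dist2 a z)" "\<bar>bubble_Im z\<bar> \<le> 2 / sqrt (pole_dist2 a z)" if "Im z < 0" for z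
    unfolding bubble_Re_Im_eq[OF that] norm_bubble_lower[OF that, symmetric]
    by (rule abs_Re_le_cmod, rule abs_Im_le_cmod)
  have pr: "\<bar>partial b bubble_Re z\<bar> \<le> 2 / pole_dist2 a z" "\<bar>partial b bubble_Im z\<bar> \<le> 2 / pole_dist2 a z"
    if "b \<in> {1, \<i>}" "Im z < 0" for b z
    unfolding pRe[OF that(2)] pIm[OF that(2)] nb[OF that(1), of z, symmetric]
    by (rule abs_Re_le_cmod, rule abs_Im_le_cmod)
  have R: "integrable lborel (\<lambda>z. partial \<i> bubble_Re z *\<^sub>R k\<^sub>1 z)"
    "integrable lborel (\<lambda>z. partial 1 bubble_Re z *\<^sub>R k\<^sub>2 z)"
    "(LINT z|lborel. partial \<i> bubble_Re z *\<^sub>R k\<^sub>1 z) = (LINT z|lborel. partial 1 bubble_Re z *\<^sub>R k\<^sub>2 z)"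
    by (rule integral_curl_cutoff[OF Ck_bubble_Re r(1) pr(1) k L2 zero]; assumption)+
  have I: "integrable lborel (\<lambda>z. partial \<i> bubble_Im z *\<^sub>R k\<^sub>1 z)"
    "integrable lborel (\<lambda>z. partial 1 bubble_Im z *\<^sub>R k\<^sub>2 z)"
    "(LINT z|lborel. partial \<i> bubble_Im z *\<^sub>R k\<^sub>1 z) = (LINT z|lborel. partial 1 bubble_Im z *\<^sub>R k\<^sub>2 z)"
    by (rule integral_curl_cutoff[OF Ck_bubble_Im r(2) pr(2) k L2 zero]; assumption)+
  \<comment> \<open>Writing \<open>h' = p + \<i> q\<close>, the horizontal derivatives of
    \<open>Re h\<close> and \<open>Im h\<close> are \<open>p\<close> and \<open>q\<close>, the
    vertical ones \<open>- q\<close> and \<open>p\<close>. The first two terms pair the rotated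
    gradient of \<open>Im h\<close> with the real part of \<open>\<nabla>w\<close>, the last two
    that of \<open>- Re h\<close> with its imaginary part; each pair integrates to 0.\<close>
  let ?f = "\<lambda>z. Re (partial \<i> bubble_Im z *\<^sub>R k\<^sub>1 z) - Re (partial 1 bubble_Im z *\<^sub>R k\<^sub>2 z)
      - Im (partial \<i> bubble_Re z *\<^sub>R k\<^sub>1 z) + Im (partial 1 bubble_Re z *\<^sub>R k\<^sub>2 z)"
  note [measurable] = is_weak_partialD(2)[OF k(1)] is_weak_partialD(2)[OF k(2)]
    bubble_measurable[OF a] bubble_deriv_i_measurable[OF a]
  have "(LINT z|lborel. bubble_deriv a z \<bullet> k\<^sub>1 z + bubble_deriv_i a z \<bullet> k\<^sub>2 z) = (LINT z|lborel. ?f z)"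
  proof (rule integral_cong_AE)
    show "AE z in lborel. bubble_deriv a z \<bullet> k\<^sub>1 z + bubble_deriv_i a z \<bullet> k\<^sub>2 z = ?f z"
      using zero
    proof eventually_elim
      fix z assume "0 \<le> Im z \<longrightarrow> k\<^sub>1 z = 0" "0 \<le> Im z \<longrightarrow> k\<^sub>2 z = 0"
      then show "bubble_deriv a z \<bullet> k\<^sub>1 z + bubble_deriv_i a z \<bullet> k\<^sub>2 z = ?f z"
        by (cases "Im z < 0") (auto simp: pRe pIm bubble_deriv_i_def[OF a] inner_complex_def)
    qed
    note [measurable] = Ck_partial_measurable[OF Ck_bubble_Re complex_Basis(1)]
      Ck_partial_measurable[OF Ck_bubble_Re complex_Basis(2)]
      Ck_partial_measurable[OF Ck_bubble_Im complex_Basis(1)]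
      Ck_partial_measurable[OF Ck_bubble_Im complex_Basis(2)]
    show "?f \<in> borel_measurable lborel" by simp
  qed simp
  also have "\<dots> = Re (LINT z|lborel. partial \<i> bubble_Im z *\<^sub>R k\<^sub>1 z) - Re (LINT z|lborel. partial 1 bubble_Im z *\<^sub>R k\<^sub>2 z)
      - Im (LINT z|lborel. partial \<i> bubble_Re z *\<^sub>R k\<^sub>1 z) + Im (LINT z|lborel. partial 1 bubble_Re z *\<^sub>R k\<^sub>2 z)"
    using R(1,2)[THEN integrable_Im] I(1,2)[THEN integrable_Re]
    by (simp only: integral_Re[OF I(1), symmetric] integral_Re[OF I(2), symmetric]
        integral_Im[OF R(1), symmetric] integral_Im[OF R(2), symmetric]
        Bochner_Integration.integral_add Bochner_Integration.integral_diff Bochner_Integration.integrable_diff)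
  also have "\<dots> = 0" by (simp add: R(3) I(3))
  finally show ?thesis .
qed

end

subsection \<open>Minimality and uniqueness\<close>

lemma integrable_sq_if_dirichlet_energy_finite:
  assumes g: "is_weak_partial 1 v g\<^sub>1" "is_weak_partial \<i> v g\<^sub>2" and fin: "dirichlet_energy v < \<infinity>"
  shows "integrable lborel (\<lambda>z. (norm (g\<^sub>1 z))\<^sup>2)" "integrable lborel (\<lambda>z. (norm (g\<^sub>2 z))\<^sup>2)"
proof -
  note [measurable] = is_weak_partialD(2)[OF g(1)] is_weak_partialD(2)[OF g(2)]
  have i: "integrable lborel (\<lambda>z. (norm (g\<^sub>1 z))\<^sup>2 + (norm (g\<^sub>2 z))\<^sup>2)"
    by (rule integrableI_bounded) (use fin in \<open>simp_all add: dirichlet_energy_eq[OF g]\<close>)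
  show "integrable lborel (\<lambda>z. (norm (g\<^sub>1 z))\<^sup>2)" "integrable lborel (\<lambda>z. (norm (g\<^sub>2 z))\<^sup>2)"
    by (rule Bochner_Integration.integrable_bound[OF i]; simp)+
qed

text \<open>For finite energy, expanding the square around \<open>bubble a\<close> and dropping the
  orthogonal cross term gives the energy \<open>4 pi / a^2 + K\<close> with \<open>K \<ge> 0\<close>
  the energy of the difference. If \<open>K = 0\<close>, the difference has no vertical derivative
  and, being 0 above the real line, is 0 below it as well.\<close>

lemma bubble_minimal:
  assumes a: "0 < a" and v: "H1_loc v" and ext: "AE z in lborel. 0 \<le> Im z \<longrightarrow> v z = bubble a z"
  shows "ennreal (4 * pi / a\<^sup>2) \<le> dirichlet_energy v"
    and "dirichlet_energy v = ennreal (4 * pi / a\<^sup>2) \<Longrightarrow> AE z in lborel. v z = bubble a z"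
proof -
  define g\<^sub>1 g\<^sub>2 where "g\<^sub>1 = bubble_deriv a" and "g\<^sub>2 = bubble_deriv_i a"
  have g: "is_weak_partial 1 (bubble a) g\<^sub>1" "is_weak_partial \<i> (bubble a) g\<^sub>2"
    unfolding g\<^sub>1_def g\<^sub>2_def by (rule bubble_weak_partial_1[OF a], rule bubble_weak_partial_i[OF a])
  from v have vL: "L2_loc v" by (simp add: H1_loc_def)
  from v obtain p\<^sub>1 p\<^sub>2 where p: "is_weak_partial 1 v p\<^sub>1" "is_weak_partial \<i> v p\<^sub>2"
    using complex_Basis unfolding H1_loc_def by blast
  define w k\<^sub>1 k\<^sub>2 where "w = (\<lambda>z. v z - bubble a z)" and "k\<^sub>1 = (\<lambda>z. p\<^sub>1 z - g\<^sub>1 z)" and "k\<^sub>2 = (\<lambda>z. p\<^sub>2 z - g\<^sub>2 z)"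
  have k: "is_weak_partial 1 w k\<^sub>1" "is_weak_partial \<i> w k\<^sub>2"
    unfolding w_def k\<^sub>1_def k\<^sub>2_def
    by (intro is_weak_partial_diff complex_Basis vL bubble_L2_loc[OF a] p g)+
  note [measurable] = is_weak_partialD(2)[OF p(1)] is_weak_partialD(2)[OF p(2)]
    is_weak_partialD(2)[OF g(1)] is_weak_partialD(2)[OF g(2)]
    is_weak_partialD(2)[OF k(1)] is_weak_partialD(2)[OF k(2)]
  have wL: "L2_loc w" unfolding w_def by (rule L2_loc_diff[OF vL bubble_L2_loc[OF a]])
  have w0: "AE z in lborel. 0 \<le> Im z \<longrightarrow> w z = 0"
    using ext by eventually_elim (simp add: w_def)
  \<comment> \<open>Vanishing is known on the open upper half-plane; the real line is added as a
    null set.\<close>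
  have k0: "AE z in lborel. 0 \<le> Im z \<longrightarrow> k\<^sub>1 z = 0" "AE z in lborel. 0 \<le> Im z \<longrightarrow> k\<^sub>2 z = 0"
    using weak_partial_eq_0_upper[OF complex_Basis(1) k(1) w0] AE_Im_neq_0
      weak_partial_eq_0_upper[OF complex_Basis(2) k(2) w0]
    by (eventually_elim, auto)+
  have gE: "(norm (g\<^sub>1 z))\<^sup>2 + (norm (g\<^sub>2 z))\<^sup>2 = 8 / (pole_dist2 a z)\<^sup>2" for z
    unfolding g\<^sub>1_def g\<^sub>2_def by (rule bubble_energy_density[OF a])
  have gi: "integrable lborel (\<lambda>z. (norm (g\<^sub>1 z))\<^sup>2)" "integrable lborel (\<lambda>z. (norm (g\<^sub>2 z))\<^sup>2)"
    using integrable_sq_if_dirichlet_energy_finite[OF g] by (simp_all add: bubble_energy[OF a])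
  have gI: "(LINT z|lborel. (norm (g\<^sub>1 z))\<^sup>2 + (norm (g\<^sub>2 z))\<^sup>2) = 4 * pi / a\<^sup>2"
    unfolding gE using nn_integral_pole_dist2[OF a] pole_dist2_measurable[OF a]
    by (subst integral_eq_nn_integral) simp_all
  have finite: "ennreal (4 * pi / a\<^sup>2) \<le> dirichlet_energy v \<and>
      (dirichlet_energy v = ennreal (4 * pi / a\<^sup>2) \<longrightarrow> (AE z in lborel. v z = bubble a z))"
    if fin: "dirichlet_energy v < \<infinity>"
  proof -
    note pi = integrable_sq_if_dirichlet_energy_finite[OF p fin]
    have ki: "integrable lborel (\<lambda>z. (norm (k\<^sub>1 z))\<^sup>2)" "integrable lborel (\<lambda>z. (norm (k\<^sub>2 z))\<^sup>2)"
    proof -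
      have le: "norm ((norm (x - y))\<^sup>2) \<le> norm (2 * (norm x)\<^sup>2 + 2 * (norm y)\<^sup>2)" for x y :: complex
        using norm_add_squared_le[of x "- y"] by simp
      show "integrable lborel (\<lambda>z. (norm (k\<^sub>1 z))\<^sup>2)"
        by (rule Bochner_Integration.integrable_bound[where f = "\<lambda>z. 2 * (norm (p\<^sub>1 z))\<^sup>2 + 2 * (norm (g\<^sub>1 z))\<^sup>2"])
          (use pi gi le in \<open>simp_all add: k\<^sub>1_def\<close>)
      show "integrable lborel (\<lambda>z. (norm (k\<^sub>2 z))\<^sup>2)"
        by (rule Bochner_Integration.integrable_bound[where f = "\<lambda>z. 2 * (norm (p\<^sub>2 z))\<^sup>2 + 2 * (norm (g\<^sub>2 z))\<^sup>2"])
          (use pi gi le in \<open>simp_all add: k\<^sub>2_def\<close>)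
    qed
    have orth: "(LINT z|lborel. g\<^sub>1 z \<bullet> k\<^sub>1 z + g\<^sub>2 z \<bullet> k\<^sub>2 z) = 0"
      unfolding g\<^sub>1_def g\<^sub>2_def by (rule bubble_orthogonal[OF a k ki k0])
    have expand: "(norm x)\<^sup>2 = (norm y)\<^sup>2 + 2 * (y \<bullet> (x - y)) + (norm (x - y))\<^sup>2" for x y :: complex
      by (simp add: power2_norm_eq_inner inner_diff_left inner_diff_right inner_commute)
    have pE: "(norm (p\<^sub>1 z))\<^sup>2 + (norm (p\<^sub>2 z))\<^sup>2 = ((norm (g\<^sub>1 z))\<^sup>2 + (norm (g\<^sub>2 z))\<^sup>2)
        + 2 * (g\<^sub>1 z \<bullet> k\<^sub>1 z + g\<^sub>2 z \<bullet> k\<^sub>2 z) + ((norm (k\<^sub>1 z))\<^sup>2 + (norm (k\<^sub>2 z))\<^sup>2)" for z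
      unfolding k\<^sub>1_def k\<^sub>2_def expand[of "p\<^sub>1 z" "g\<^sub>1 z"] expand[of "p\<^sub>2 z" "g\<^sub>2 z"] by simp
    \<comment> \<open>Integrability of the cross term is read off the expansion, whose other three
      terms are integrable.\<close>
    have ii: "integrable lborel (\<lambda>z. g\<^sub>1 z \<bullet> k\<^sub>1 z + g\<^sub>2 z \<bullet> k\<^sub>2 z)"
    proof -
      have "g\<^sub>1 z \<bullet> k\<^sub>1 z + g\<^sub>2 z \<bullet> k\<^sub>2 z = (1 / 2) * (((norm (p\<^sub>1 z))\<^sup>2 + (norm (p\<^sub>2 z))\<^sup>2)
          - ((norm (g\<^sub>1 z))\<^sup>2 + (norm (g\<^sub>2 z))\<^sup>2) - ((norm (k\<^sub>1 z))\<^sup>2 + (norm (k\<^sub>2 z))\<^sup>2))" for z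
        unfolding pE by simp
      then show ?thesis
        by (simp only:) (intro integrable_mult_right Bochner_Integration.integrable_diff
            Bochner_Integration.integrable_add pi gi ki)
    qed
    define K where "K = (LINT z|lborel. (norm (k\<^sub>1 z))\<^sup>2 + (norm (k\<^sub>2 z))\<^sup>2)"
    have K: "0 \<le> K" unfolding K_def by simp
    have "(LINT z|lborel. (norm (p\<^sub>1 z))\<^sup>2 + (norm (p\<^sub>2 z))\<^sup>2) = 4 * pi / a\<^sup>2 + 2 * 0 + K"
      unfolding pE K_def gI[symmetric] orth[symmetric] using ii gi ki by (simp del: distrib_left_numeral)
    moreover have "dirichlet_energy v = ennreal (LINT z|lborel. (norm (p\<^sub>1 z))\<^sup>2 + (norm (p\<^sub>2 z))\<^sup>2)"
      unfolding dirichlet_energy_eq[OF p] using pi by (subst nn_integral_eq_integral) simp_all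
    ultimately have E: "dirichlet_energy v = ennreal (4 * pi / a\<^sup>2 + K)" by simp
    have "AE z in lborel. v z = bubble a z" if "dirichlet_energy v = ennreal (4 * pi / a\<^sup>2)"
    proof -
      have "4 * pi / a\<^sup>2 + K = 4 * pi / a\<^sup>2"
        using that K unfolding E by (subst (asm) ennreal_inj) simp_all
      then have "K = 0" by simp
      then have "AE z in lborel. (norm (k\<^sub>1 z))\<^sup>2 + (norm (k\<^sub>2 z))\<^sup>2 = 0"
        unfolding K_def using ki by (subst (asm) integral_nonneg_eq_0_iff_AE) simp_all
      then have "AE z in lborel. k\<^sub>2 z = 0"
        by eventually_elim (simp add: add_nonneg_eq_0_iff)
      then have "is_weak_partial \<i> w (\<lambda>_. 0)"
        by (intro is_weak_partial_cong_AE[OF k(2)] L2_loc_bounded[where C = 0]) simp_all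
      from AE_eq_0_if_weak_partial_eq_0[OF wL this w0]
      show ?thesis by eventually_elim (simp add: w_def)
    qed
    with E K show ?thesis by (simp add: ennreal_leI)
  qed
  then show "ennreal (4 * pi / a\<^sup>2) \<le> dirichlet_energy v"
    by (cases "dirichlet_energy v = \<infinity>") (auto simp: top.not_eq_extremum)
  show "AE z in lborel. v z = bubble a z" if "dirichlet_energy v = ennreal (4 * pi / a\<^sup>2)"
    using finite that by simp
qed

section \<open>The linear term of the limiting energy, and the conclusion\<close>

lemma exchange_integral:
  "(LINT x|lborel. horizontal (mat 1 *v Phi x) \<bullet> gradient (\<lambda>y. Phi y $ 3) x) = 4 * pi"
proof -
  \<comment> \<open>Since \<open>Phi x $ 3 = 2 / (1 + |x|^2) - 1\<close>, its gradient is
    \<open>- 4 x / (1 + |x|^2)^2\<close>; the horizontal part of \<open>Phi x\<close> is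
    \<open>- 2 x / (1 + |x|^2)\<close>.\<close>
  have "horizontal (mat 1 *v Phi x) \<bullet> gradient (\<lambda>y. Phi y $ 3) x
      = 8 * (norm x)\<^sup>2 / (1 + (norm x)\<^sup>2) ^ 3" for x
  proof -
    have n: "(norm y)\<^sup>2 = Re y * Re y + Im y * Im y" for y
      unfolding cmod_power2 by (simp add: power2_eq_square)
    define N where "N = 1 + (Re x * Re x + Im x * Im x)"
    have N: "N \<noteq> 0" unfolding N_def using sum_squares_ge_zero[of "Re x" "Im x"] by linarith
    have "((\<lambda>y. Phi y $ 3) has_derivative (\<lambda>h. - 4 * (Re x * Re h + Im x * Im h) / (N * N))) (at x)"
      unfolding Phi_def n vector_3 using N
      by (auto intro!: derivative_eq_intros simp: fun_eq_iff N_def[symmetric] divide_simps)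
        (simp add: N_def algebra_simps)
    note p = partial_has_derivative[OF this]
    show ?thesis
      unfolding gradient_def p
      using N by (simp add: horizontal_def Phi_def inner_complex_def n N_def[symmetric] divide_simps)
        (simp add: algebra_simps power_numeral_reduce)
  qed
  moreover have "(LINT x::complex|lborel. 8 * (norm x)\<^sup>2 / (1 + (norm x)\<^sup>2) ^ 3) = 4 * pi"
    by (subst integral_eq_nn_integral) (simp_all add: nn_integral_exchange)
  ultimately show ?thesis by simp
qed

theorem proposition2p12:
  fixes \<Omega> :: "complex set" and y0 :: real and u :: "complex \<Rightarrow> complex"
  assumes Omega: "\<Omega> = {z. Im z < 0}"
    and y0: "y0 < 0"
    and u: "u = (\<lambda>z. if z \<in> \<Omega> then 2 / (z + \<i> * of_real y0)
                                 else 2 / (cnj z + \<i> * of_real y0))"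
  shows "achieves_T \<Omega> y0 u
    \<and> (\<forall>v. achieves_T \<Omega> y0 v \<longrightarrow> (AE z in lborel. v z = u z))
    \<and> T \<Omega> y0 = ennreal (4 * pi / y0\<^sup>2)
    \<and> (\<forall>r0. is_rescaled_skyrmion_radius \<Omega> y0 r0 \<longleftrightarrow> r0 = y0\<^sup>2)
    \<and> 4 * pi / enn2real (T \<Omega> y0) = y0\<^sup>2
    \<and> limiting_energy \<Omega> (mat 1) (y0\<^sup>2) y0 = - 4 * pi * y0\<^sup>2"
proof -
  define a where "a = - y0"
  have a: "0 < a" and a2: "a\<^sup>2 = y0\<^sup>2" using y0 by (simp_all add: a_def)
  have ub: "u = bubble a"
  proof
    fix z
    have "fold_lower z = (if z \<in> \<Omega> then z else cnj z)"
      by (simp add: fold_lower_def Omega complex_eq_iff)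
    then show "u z = bubble a z" by (simp add: u bubble_def a_def)
  qed
  have adm: "admissible \<Omega> y0 v \<longleftrightarrow> H1_loc v \<and> (AE z in lborel. 0 \<le> Im z \<longrightarrow> v z = bubble a z)" for v
  proof -
    have "(z \<in> - \<Omega> \<longrightarrow> v z = 2 / (cnj z + \<i> * of_real y0)) \<longleftrightarrow> (0 \<le> Im z \<longrightarrow> v z = bubble a z)" for z
      unfolding ub[symmetric] by (auto simp: u Omega)
    then show ?thesis by (simp only: admissible_def)
  qed
  have uadm: "admissible \<Omega> y0 u"
    unfolding adm ub H1_loc_def
    using bubble_L2_loc[OF a] bubble_weak_partial_1[OF a] bubble_weak_partial_i[OF a]
    by (auto simp: Basis_complex_def)
  have uE: "dirichlet_energy u = ennreal (4 * pi / a\<^sup>2)" unfolding ub by (rule bubble_energy[OF a])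
  have T: "T \<Omega> y0 = ennreal (4 * pi / a\<^sup>2)"
    unfolding T_def
  proof (rule antisym)
    show "(INF v\<in>{v. admissible \<Omega> y0 v}. dirichlet_energy v) \<le> ennreal (4 * pi / a\<^sup>2)"
      using uadm by (intro INF_lower2[of u]) (simp_all add: uE)
    show "ennreal (4 * pi / a\<^sup>2) \<le> (INF v\<in>{v. admissible \<Omega> y0 v}. dirichlet_energy v)"
      using bubble_minimal(1)[OF a] by (intro INF_greatest) (simp add: adm)
  qed
  have Tr: "enn2real (T \<Omega> y0) = 4 * pi / y0\<^sup>2" by (simp add: T a2)
  \<comment> \<open>Completing the square in \<open>4 pi r^2 / y0^2 - 2 r * 4 pi\<close> exhibits
    the minimizer, its uniqueness and the minimal value at once.\<close>
  have E: "limiting_energy \<Omega> (mat 1) r y0 = 4 * pi / y0\<^sup>2 * (r - y0\<^sup>2)\<^sup>2 - 4 * pi * y0\<^sup>2" for r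
    unfolding limiting_energy_def exchange_integral Tr using y0
    by (simp add: field_simps power2_eq_square)
  have rad: "is_rescaled_skyrmion_radius \<Omega> y0 r0 \<longleftrightarrow> r0 = y0\<^sup>2" for r0
  proof
    assume "is_rescaled_skyrmion_radius \<Omega> y0 r0"
    then have "\<not> limiting_energy \<Omega> (mat 1) (y0\<^sup>2) y0 < limiting_energy \<Omega> (mat 1) r0 y0"
      using y0 by (auto simp: is_rescaled_skyrmion_radius_def is_arg_min_def)
    then have "4 * pi / y0\<^sup>2 * (r0 - y0\<^sup>2)\<^sup>2 \<le> 0" by (simp add: E)
    moreover have "0 < 4 * pi / y0\<^sup>2" using y0 by simp
    ultimately have "(r0 - y0\<^sup>2)\<^sup>2 \<le> 0" by (simp only: mult_le_0_iff) linarith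
    then show "r0 = y0\<^sup>2" by simp
  next
    assume "r0 = y0\<^sup>2"
    then show "is_rescaled_skyrmion_radius \<Omega> y0 r0"
      using y0 by (simp add: is_rescaled_skyrmion_radius_def is_arg_min_def E not_less)
  qed
  have "AE z in lborel. v z = u z" if "achieves_T \<Omega> y0 v" for v
    using that bubble_minimal(2)[OF a, of v] by (simp add: achieves_T_def adm T ub)
  with uadm uE T rad Tr E[of "y0\<^sup>2"] y0 show ?thesis
    by (simp add: achieves_T_def a2)
qed

end
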